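(* Suppose that $f(X_1,\dots,X_d)\in L^1$. Then, as $n\to\infty$, $$U_n\Big/\binom nd\ \longrightarrow\ \mu\qquad\text{almost surely.}$$
   Context: $X_1,X_2,\dots$ is an i.i.d. sequence of random variables with values in an arbitrary measurable space $(S,\mathcal S)$; $d\ge1$ is a fixed integer and $f:S^d\to\mathbb R$ is measurable (no symmetry assumed). $U_n:=\sum_{1\le i_1<\dots<i_d\le n}f(X_{i_1},\dots,X_{i_d})$ and $\mu:=\mathbb E f(X_1,\dots,X_d)$. *)

theory Defs
  imports "HOL-Probability.Probability"
begin

text \<open>A point of \<open>S\<^sup>d\<close> is an extensional function on \<open>{1..d}\<close>, i.e. an element of
  \<open>space (PiM {1..d} (\<lambda>_. S))\<close>; this is why tuples are built with \<open>restrict\<close> and index tuples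
  \<open>i\<^sub>1 < \<dots> < i\<^sub>d\<close> are taken from \<open>\<rightarrow>\<^sub>E\<close>, so that each is counted exactly once.\<close>

definition index_tuples :: "nat \<Rightarrow> nat \<Rightarrow> (nat \<Rightarrow> nat) set" where
  "index_tuples d n = {i \<in> {1..d} \<rightarrow>\<^sub>E {1..n}. strict_mono_on {1..d} i}"

definition U_stat ::
  "nat \<Rightarrow> ((nat \<Rightarrow> 's) \<Rightarrow> real) \<Rightarrow> (nat \<Rightarrow> 'a \<Rightarrow> 's) \<Rightarrow> nat \<Rightarrow> 'a \<Rightarrow> real" where
  "U_stat d f X n \<omega> = (\<Sum>i\<in>index_tuples d n. f (\<lambda>k\<in>{1..d}. X (i k) \<omega>))"

text \<open>The sequence is \<open>X 1, X 2, \<dots>\<close>; \<open>X 0\<close> is unconstrained. \<open>indep_vars\<close> includes the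
  measurability of each \<open>X i\<close>.\<close>

definition iid_sequence :: "'a measure \<Rightarrow> 's measure \<Rightarrow> (nat \<Rightarrow> 'a \<Rightarrow> 's) \<Rightarrow> bool" where
  "iid_sequence M S X \<longleftrightarrow>
     prob_space.indep_vars M (\<lambda>_. S) X {1..} \<and>
     (\<forall>i\<ge>1. \<forall>j\<ge>1. distr M S (X i) = distr M S (X j))"

end

theory Submission
  imports Defs
begin

text \<open>
  The proof extends Etemadi's argument for \<open>d = 1\<close>. By splitting \<open>f\<close> into positive and negative
  part one may take \<open>f \<ge> 0\<close>; then \<open>U\<^sub>n\<close> is nondecreasing, so convergence along the sequences
  \<open>n\<^sub>k = \<lceil>\<alpha>\<^sup>k\<rceil>\<close>, with \<open>\<alpha>\<close> decreasing to \<open>1\<close>, suffices. For a nonempty set \<open>A\<close> of coordinates let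
  \<open>G\<^sub>A\<close> be the conditional mean of \<open>f\<close> given the coordinates in \<open>A\<close>. At stage \<open>n\<close> the kernel is
  set to zero wherever some \<open>G\<^sub>A\<close> exceeds \<open>n^|A|\<close>. Two index tuples without a common
  index give uncorrelated terms, and there are \<open>O(n^(2d - c))\<close> pairs with \<open>c\<close>
  common indices, so after division by \<open>n^(2d)\<close> the variance is bounded by a sum over
  \<open>A\<close> of truncated second moments of \<open>G\<^sub>A\<close> divided by \<open>n^|A|\<close>. Along \<open>n\<^sub>k\<close> these
  bounds, and the probabilities that the truncation changes any term, are sums of geometric type
  controlled by the mean of \<open>G\<^sub>A\<close>, which is the mean of \<open>f\<close>.
\<close>

subsection \<open>Resampling coordinates of a product measure\<close>

lemma override_on_in_space_PiM:
  assumes "x \<in> space (PiM I M)" "y \<in> space (PiM I M)"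
  shows "override_on y x A \<in> space (PiM I M)"
  using assms by (auto simp: space_PiM PiE_iff override_on_def extensional_def)

lemma measurable_override_on [measurable]:
  assumes "g \<in> N \<rightarrow>\<^sub>M PiM I M" "h \<in> N \<rightarrow>\<^sub>M PiM I M"
  shows "(\<lambda>x. override_on (g x) (h x) A) \<in> N \<rightarrow>\<^sub>M PiM I M"
proof (rule measurable_PiM_single')
  fix i assume i: "i \<in> I"
  show "(\<lambda>\<omega>. override_on (g \<omega>) (h \<omega>) A i) \<in> N \<rightarrow>\<^sub>M M i"
    by (cases "i \<in> A") (simp_all add: measurable_compose[OF assms(1) measurable_component_singleton[OF i]]
        measurable_compose[OF assms(2) measurable_component_singleton[OF i]])
next
  show "(\<lambda>\<omega>. override_on (g \<omega>) (h \<omega>) A) \<in> space N \<rightarrow> (\<Pi>\<^sub>E i\<in>I. space (M i))"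
    using override_on_in_space_PiM[OF measurable_space[OF assms(2)] measurable_space[OF assms(1)]]
    by (auto simp: space_PiM)
qed

text \<open>If x and y are independent draws, \<open>override_on y x A\<close> reads each coordinate
  from exactly one of them, so its coordinates are again independent with law \<open>M\<close>. On
  cylinders this is visible directly: the preimage is a rectangle whose sides constrain the disjoint
  coordinate sets \<open>J \<inter> A\<close> and \<open>J - A\<close>.\<close>

lemma (in prob_space) distr_override_on:
  "distr (PiM I (\<lambda>_. M) \<Otimes>\<^sub>M PiM I (\<lambda>_. M)) (PiM I (\<lambda>_. M)) (\<lambda>(x, y). override_on y x A) = PiM I (\<lambda>_. M)"
    (is "?D = ?Q")
proof -
  interpret product_prob_space "\<lambda>_. M" I
    by unfold_locales
  interpret PP: pair_sigma_finite ?Q ?Q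
    by unfold_locales
  show ?thesis
  proof (rule PiM_eq)
    fix J F assume J: "finite J" "J \<subseteq> I" and F: "\<And>j. j \<in> J \<Longrightarrow> F j \<in> sets M"
    let ?E = "prod_emb I (\<lambda>_. M) J (Pi\<^sub>E J F)"
    let ?E1 = "prod_emb I (\<lambda>_. M) (J \<inter> A) (Pi\<^sub>E (J \<inter> A) F)"
    let ?E2 = "prod_emb I (\<lambda>_. M) (J - A) (Pi\<^sub>E (J - A) F)"
    have [measurable]: "?E \<in> sets ?Q" "?E1 \<in> sets ?Q" "?E2 \<in> sets ?Q"
      using J F by (auto intro!: sets_PiM_I)
    have "emeasure ?D ?E = emeasure (?Q \<Otimes>\<^sub>M ?Q) ((\<lambda>(x, y). override_on y x A) -` ?E \<inter> space (?Q \<Otimes>\<^sub>M ?Q))"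
      by (rule emeasure_distr) simp_all
    also have "(\<lambda>(x, y). override_on y x A) -` ?E \<inter> space (?Q \<Otimes>\<^sub>M ?Q) = ?E1 \<times> ?E2"
      using J by (auto simp: prod_emb_iff space_pair_measure space_PiM PiE_iff override_on_def
          extensional_def subset_eq split: if_splits)
    also have "emeasure (?Q \<Otimes>\<^sub>M ?Q) (?E1 \<times> ?E2) = emeasure ?Q ?E1 * emeasure ?Q ?E2"
      by (rule P.emeasure_pair_measure_Times) simp_all
    also have "\<dots> = (\<Prod>j\<in>J \<inter> A. emeasure M (F j)) * (\<Prod>j\<in>J - A. emeasure M (F j))"
      using J F by (subst (1 2) emeasure_PiM_emb) auto
    also have "\<dots> = (\<Prod>j\<in>J. emeasure M (F j))"
      using prod.Int_Diff[OF J(1), of "\<lambda>j. emeasure M (F j)" A] by simp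
    finally show "emeasure ?D ?E = (\<Prod>j\<in>J. emeasure M (F j))" .
  qed simp
qed

text \<open>The tower property: the inner integral averages over the coordinates outside
  \<open>A\<close> while those in \<open>A\<close> are held at x.\<close>

lemma (in prob_space) nn_integral_PiM_override_on:
  assumes [measurable]: "H \<in> borel_measurable (PiM I (\<lambda>_. M))"
  shows "(\<integral>\<^sup>+x. \<integral>\<^sup>+y. H (override_on y x A) \<partial>PiM I (\<lambda>_. M) \<partial>PiM I (\<lambda>_. M)) =
    (\<integral>\<^sup>+x. H x \<partial>PiM I (\<lambda>_. M))"
proof -
  let ?Q = "PiM I (\<lambda>_. M)"
  interpret P: prob_space ?Q
    by (rule prob_space_PiM) (rule prob_space_axioms)
  have "(\<integral>\<^sup>+x. H x \<partial>?Q) = (\<integral>\<^sup>+x. H x \<partial>distr (?Q \<Otimes>\<^sub>M ?Q) ?Q (\<lambda>(x, y). override_on y x A))"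
    by (simp add: distr_override_on)
  also have "\<dots> = (\<integral>\<^sup>+z. H (override_on (snd z) (fst z) A) \<partial>(?Q \<Otimes>\<^sub>M ?Q))"
    by (subst nn_integral_distr) (simp_all add: case_prod_beta)
  also have "\<dots> = (\<integral>\<^sup>+x. \<integral>\<^sup>+y. H (override_on y x A) \<partial>?Q \<partial>?Q)"
    by (subst P.nn_integral_fst[symmetric]) simp_all
  finally show ?thesis ..
qed

text \<open>Injectivity of \<open>i\<close> makes the selected coordinates distinct, hence
  independent with common law \<open>M\<close>.\<close>

lemma (in prob_space) nn_integral_PiM_reindex:
  assumes "inj_on i D" "i ` D \<subseteq> I" and [measurable]: "H \<in> borel_measurable (PiM D (\<lambda>_. M))"
  shows "(\<integral>\<^sup>+x. H (\<lambda>k\<in>D. x (i k)) \<partial>PiM I (\<lambda>_. M)) = (\<integral>\<^sup>+x. H x \<partial>PiM D (\<lambda>_. M))"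
proof -
  have i: "i k \<in> I" if "k \<in> D" for k
    using assms(2) that by auto
  have "distr (PiM I (\<lambda>_. M)) (PiM D (\<lambda>_. M)) (\<lambda>x. \<lambda>k\<in>D. x (i k)) = PiM D (\<lambda>_. M)"
    using assms prob_space_axioms by (intro distr_PiM_reindex) auto
  moreover have "(\<lambda>x. \<lambda>k\<in>D. x (i k)) \<in> PiM I (\<lambda>_. M) \<rightarrow>\<^sub>M PiM D (\<lambda>_. M)"
    by (intro measurable_restrict measurable_component_singleton i)
  ultimately show ?thesis
    using nn_integral_distr[of "\<lambda>x. \<lambda>k\<in>D. x (i k)" "PiM I (\<lambda>_. M)" "PiM D (\<lambda>_. M)" H] by simp
qed

text \<open>The two invariance hypotheses express that \<open>\<phi>\<close> depends only on
  coordinates in \<open>B\<close> and \<open>\<psi>\<close> only on those outside \<open>B\<close>.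
  Resampling puts the two groups into separate integration variables.\<close>

lemma (in prob_space) nn_integral_PiM_mult:
  fixes \<phi> \<psi> :: "_ \<Rightarrow> ennreal"
  assumes [measurable]: "\<phi> \<in> borel_measurable (PiM I (\<lambda>_. M))" "\<psi> \<in> borel_measurable (PiM I (\<lambda>_. M))"
    and \<phi>: "\<And>x y. x \<in> space (PiM I (\<lambda>_. M)) \<Longrightarrow> y \<in> space (PiM I (\<lambda>_. M)) \<Longrightarrow> \<phi> (override_on y x B) = \<phi> x"
    and \<psi>: "\<And>x y. x \<in> space (PiM I (\<lambda>_. M)) \<Longrightarrow> y \<in> space (PiM I (\<lambda>_. M)) \<Longrightarrow> \<psi> (override_on y x B) = \<psi> y"
  shows "(\<integral>\<^sup>+x. \<phi> x * \<psi> x \<partial>PiM I (\<lambda>_. M)) = (\<integral>\<^sup>+x. \<phi> x \<partial>PiM I (\<lambda>_. M)) * (\<integral>\<^sup>+x. \<psi> x \<partial>PiM I (\<lambda>_. M))"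
proof -
  let ?Q = "PiM I (\<lambda>_. M)"
  have "(\<integral>\<^sup>+x. \<phi> x * \<psi> x \<partial>?Q) = (\<integral>\<^sup>+x. \<integral>\<^sup>+y. \<phi> (override_on y x B) * \<psi> (override_on y x B) \<partial>?Q \<partial>?Q)"
    by (rule nn_integral_PiM_override_on[symmetric]) simp
  also have "\<dots> = (\<integral>\<^sup>+x. \<integral>\<^sup>+y. \<phi> x * \<psi> y \<partial>?Q \<partial>?Q)"
    by (intro nn_integral_cong) (simp add: \<phi> \<psi>)
  also have "\<dots> = (\<integral>\<^sup>+x. \<phi> x \<partial>?Q) * (\<integral>\<^sup>+x. \<psi> x \<partial>?Q)"
    by (simp add: nn_integral_cmult nn_integral_multc)
  finally show ?thesis .
qed

text \<open>A conditional expectation given the coordinates in \<open>A\<close>, fixed as a concrete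
  function: the other coordinates are integrated out afresh, and the values of y on \<open>A\<close>
  are discarded. It therefore depends on the coordinates in \<open>A\<close> alone at every point,
  without exceptional null sets.\<close>

definition (in prob_space) cond_mean :: "'i set \<Rightarrow> 'i set \<Rightarrow> (('i \<Rightarrow> 'a) \<Rightarrow> ennreal) \<Rightarrow> ('i \<Rightarrow> 'a) \<Rightarrow> ennreal" where
  "cond_mean D A u x = (\<integral>\<^sup>+y. u (override_on y x A) \<partial>PiM D (\<lambda>_. M))"

lemma (in prob_space) measurable_cond_mean [measurable]:
  assumes [measurable]: "u \<in> borel_measurable (PiM D (\<lambda>_. M))"
  shows "cond_mean D A u \<in> borel_measurable (PiM D (\<lambda>_. M))"
proof -
  interpret P: prob_space "PiM D (\<lambda>_. M)"
    by (rule prob_space_PiM) (rule prob_space_axioms)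
  show ?thesis
    unfolding cond_mean_def[abs_def] by measurable
qed

lemma (in prob_space) nn_integral_cond_mean:
  assumes "u \<in> borel_measurable (PiM D (\<lambda>_. M))"
  shows "(\<integral>\<^sup>+x. cond_mean D A u x \<partial>PiM D (\<lambda>_. M)) = (\<integral>\<^sup>+x. u x \<partial>PiM D (\<lambda>_. M))"
  unfolding cond_mean_def by (rule nn_integral_PiM_override_on[OF assms])

lemma (in prob_space) cond_mean_cong:
  assumes "\<And>k. k \<in> A \<Longrightarrow> x k = x' k"
  shows "cond_mean D A u x = cond_mean D A u x'"
  unfolding cond_mean_def
  by (intro nn_integral_cong arg_cong[where f = u]) (auto simp: override_on_def assms)

text \<open>Conditioning on the coordinates that the two tuples share makes the factors independent.\<close>

lemma (in prob_space) nn_integral_overlap: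
  fixes u v :: "('k \<Rightarrow> 'a) \<Rightarrow> ennreal" and i j :: "'k \<Rightarrow> 'i"
  assumes [measurable]: "u \<in> borel_measurable (PiM D (\<lambda>_. M))" "v \<in> borel_measurable (PiM D (\<lambda>_. M))"
    and i: "inj_on i D" "i ` D \<subseteq> I" and j: "inj_on j D" "j ` D \<subseteq> I"
  shows "(\<integral>\<^sup>+x. u (\<lambda>k\<in>D. x (i k)) * v (\<lambda>k\<in>D. x (j k)) \<partial>PiM I (\<lambda>_. M)) =
    (\<integral>\<^sup>+x. cond_mean D {k\<in>D. i k \<in> j ` D} u (\<lambda>k\<in>D. x (i k)) *
           cond_mean D {k\<in>D. j k \<in> i ` D} v (\<lambda>k\<in>D. x (j k)) \<partial>PiM I (\<lambda>_. M))"
proof -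
  let ?Q = "PiM I (\<lambda>_. M)" and ?C = "i ` D \<inter> j ` D"
  let ?A = "{k\<in>D. i k \<in> j ` D}" and ?B = "{k\<in>D. j k \<in> i ` D}"
  have iI: "i k \<in> I" and jI: "j k \<in> I" if "k \<in> D" for k
    using that i j by auto
  have [measurable]: "(\<lambda>x. \<lambda>k\<in>D. x (i k)) \<in> ?Q \<rightarrow>\<^sub>M PiM D (\<lambda>_. M)"
      "(\<lambda>x. \<lambda>k\<in>D. x (j k)) \<in> ?Q \<rightarrow>\<^sub>M PiM D (\<lambda>_. M)"
    by (auto intro!: measurable_restrict measurable_component_singleton iI jI)
  have "(\<integral>\<^sup>+x. u (\<lambda>k\<in>D. x (i k)) * v (\<lambda>k\<in>D. x (j k)) \<partial>?Q) =
    (\<integral>\<^sup>+x. \<integral>\<^sup>+y. u (\<lambda>k\<in>D. override_on y x ?C (i k)) * v (\<lambda>k\<in>D. override_on y x ?C (j k)) \<partial>?Q \<partial>?Q)"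
    by (rule nn_integral_PiM_override_on[symmetric]) simp
  also have "\<dots> = (\<integral>\<^sup>+x. cond_mean D ?A u (\<lambda>k\<in>D. x (i k)) * cond_mean D ?B v (\<lambda>k\<in>D. x (j k)) \<partial>?Q)"
  proof (rule nn_integral_cong)
    fix x assume x: "x \<in> space ?Q"
    have xi: "x (i k) \<in> space M" and xj: "x (j k) \<in> space M" if "k \<in> D" for k
      using x that iI jI by (auto simp: space_PiM)
    have "(\<lambda>y. override_on y x ?C (i k)) \<in> ?Q \<rightarrow>\<^sub>M M"
      and "(\<lambda>y. override_on y x ?C (j k)) \<in> ?Q \<rightarrow>\<^sub>M M" if "k \<in> D" for k
      using that xi xj by (cases "i k \<in> ?C"; cases "j k \<in> ?C"; simp add: iI jI measurable_component_singleton)+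
    then have mi: "(\<lambda>y. \<lambda>k\<in>D. override_on y x ?C (i k)) \<in> ?Q \<rightarrow>\<^sub>M PiM D (\<lambda>_. M)"
      and mj: "(\<lambda>y. \<lambda>k\<in>D. override_on y x ?C (j k)) \<in> ?Q \<rightarrow>\<^sub>M PiM D (\<lambda>_. M)"
      by (auto intro!: measurable_restrict)
    have "(\<integral>\<^sup>+y. u (\<lambda>k\<in>D. override_on y x ?C (i k)) * v (\<lambda>k\<in>D. override_on y x ?C (j k)) \<partial>?Q) =
        (\<integral>\<^sup>+y. u (\<lambda>k\<in>D. override_on y x ?C (i k)) \<partial>?Q) * (\<integral>\<^sup>+y. v (\<lambda>k\<in>D. override_on y x ?C (j k)) \<partial>?Q)"
    \<comment> \<open>With the indices in \<open>?C\<close> frozen at x, the first factor reads y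
      only at indices used by \<open>i\<close>, the second only at indices of \<open>j\<close> that
      \<open>i\<close> does not use. The image of \<open>i\<close> therefore separates them.\<close>
    proof (rule nn_integral_PiM_mult[where B = "i ` D"])
      show "(\<lambda>y. u (\<lambda>k\<in>D. override_on y x ?C (i k))) \<in> borel_measurable ?Q"
        by (rule measurable_compose[OF mi assms(1)])
      show "(\<lambda>y. v (\<lambda>k\<in>D. override_on y x ?C (j k))) \<in> borel_measurable ?Q"
        by (rule measurable_compose[OF mj assms(2)])
    qed (auto intro!: arg_cong[where f = u] arg_cong[where f = v] simp: override_on_def fun_eq_iff)
    also have "(\<integral>\<^sup>+y. u (\<lambda>k\<in>D. override_on y x ?C (i k)) \<partial>?Q) =
        (\<integral>\<^sup>+y. u (override_on (\<lambda>k\<in>D. y (i k)) (\<lambda>k\<in>D. x (i k)) ?A) \<partial>?Q)"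
      by (intro nn_integral_cong arg_cong[where f = u]) (auto simp: override_on_def fun_eq_iff)
    also have "\<dots> = cond_mean D ?A u (\<lambda>k\<in>D. x (i k))"
      unfolding cond_mean_def using x
      by (intro nn_integral_PiM_reindex i) (auto intro!: measurable_compose[OF _ assms(1)] measurable_override_on
           simp: space_PiM PiE_iff iI)
    also have "(\<integral>\<^sup>+y. v (\<lambda>k\<in>D. override_on y x ?C (j k)) \<partial>?Q) =
        (\<integral>\<^sup>+y. v (override_on (\<lambda>k\<in>D. y (j k)) (\<lambda>k\<in>D. x (j k)) ?B) \<partial>?Q)"
      by (intro nn_integral_cong arg_cong[where f = v]) (auto simp: override_on_def fun_eq_iff)
    also have "\<dots> = cond_mean D ?B v (\<lambda>k\<in>D. x (j k))"
      unfolding cond_mean_def using x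
      by (intro nn_integral_PiM_reindex j) (auto intro!: measurable_compose[OF _ assms(2)] measurable_override_on
           simp: space_PiM PiE_iff jI)
    finally show "(\<integral>\<^sup>+y. u (\<lambda>k\<in>D. override_on y x ?C (i k)) * v (\<lambda>k\<in>D. override_on y x ?C (j k)) \<partial>?Q) =
        cond_mean D ?A u (\<lambda>k\<in>D. x (i k)) * cond_mean D ?B v (\<lambda>k\<in>D. x (j k))" .
  qed
  finally show ?thesis .
qed

subsection \<open>Geometric subsequences\<close>

text \<open>A geometric sum is at most \<open>r / (r - 1)\<close> times its largest term, and every
  term kept here is below \<open>w\<close>.\<close>

lemma sum_geometric_below:
  fixes r w :: real
  assumes r: "r > 1" and w: "w \<ge> 0"
  shows "(\<Sum>k<N. if r ^ k < w then r ^ k else 0) \<le> r / (r - 1) * w"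
proof -
  define T where "T = {k \<in> {..<N}. r ^ k < w}"
  have "(\<Sum>k<N. if r ^ k < w then r ^ k else 0) = (\<Sum>k\<in>T. r ^ k)"
    unfolding T_def by (rule sum.inter_filter[symmetric]) simp
  also have "\<dots> \<le> r / (r - 1) * w"
  proof (cases "T = {}")
    case True
    then show ?thesis using r w by simp
  next
    case False
    have T: "finite T" by (simp add: T_def)
    have "(\<Sum>k\<in>T. r ^ k) \<le> (\<Sum>k<Suc (Max T). r ^ k)"
      using T r by (intro sum_mono2) (auto simp: less_Suc_eq_le)
    also have "\<dots> = (r ^ Suc (Max T) - 1) / (r - 1)"
      using r by (subst geometric_sum) auto
    also have "\<dots> \<le> r / (r - 1) * r ^ Max T"
      using r by (simp add: divide_right_mono)
    also have "\<dots> \<le> r / (r - 1) * w"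
      using Max_in[OF T False] r by (intro mult_left_mono) (auto simp: T_def)
    finally show ?thesis .
  qed
  finally show ?thesis .
qed

text \<open>The dual bound: the decreasing series is controlled by its first term, which is at most
  \<open>1 / v\<close>.\<close>

lemma sum_geometric_above:
  fixes r v :: real
  assumes r: "r > 1" and v: "v > 0"
  shows "(\<Sum>k<N. if v \<le> r ^ k then 1 / r ^ k else 0) \<le> r / (r - 1) / v"
proof -
  define T where "T = {k \<in> {..<N}. v \<le> r ^ k}"
  have "(\<Sum>k<N. if v \<le> r ^ k then 1 / r ^ k else 0) = (\<Sum>k\<in>T. 1 / r ^ k)"
    unfolding T_def by (rule sum.inter_filter[symmetric]) simp
  also have "\<dots> \<le> r / (r - 1) / v"
  proof (cases "T = {}")
    case True
    then show ?thesis using r v by simp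
  next
    case False
    have T: "finite T" by (simp add: T_def)
    define m where "m = Min T"
    have m: "m \<in> T" "\<And>k. k \<in> T \<Longrightarrow> m \<le> k"
      using T False by (auto simp: m_def)
    have "(\<Sum>k\<in>T. 1 / r ^ k) \<le> (\<Sum>k\<in>(+) m ` {..<N}. 1 / r ^ k)"
    proof (rule sum_mono2)
      show "T \<subseteq> (+) m ` {..<N}"
      proof
        fix k assume k: "k \<in> T"
        then have "k = m + (k - m)" "k - m < N" using m(2)[OF k] by (auto simp: T_def)
        then show "k \<in> (+) m ` {..<N}" by blast
      qed
    qed (use r in auto)
    also have "\<dots> = (\<Sum>l<N. (1 / r) ^ l) / r ^ m"
      by (subst sum.reindex) (auto simp: power_add power_one_over sum_divide_distrib field_simps)
    also have "(\<Sum>l<N. (1 / r) ^ l) \<le> r / (r - 1)"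
    proof -
      have "(\<Sum>l<N. (1 / r) ^ l) \<le> (\<Sum>l. (1 / r) ^ l)"
        using r by (intro sum_le_suminf summable_geometric) auto
      also have "\<dots> = 1 / (1 - 1 / r)" using r by (intro suminf_geometric) auto
      also have "\<dots> = r / (r - 1)" using r by (simp add: field_simps)
      finally show ?thesis .
    qed
    also have "r / (r - 1) / r ^ m \<le> r / (r - 1) / v"
      using m(1) r v by (intro divide_left_mono) (auto simp: T_def)
    finally show ?thesis using r by (simp add: divide_right_mono)
  qed
  finally show ?thesis .
qed

text \<open>One sum for two purposes: with \<open>b k\<close> as threshold and \<open>w\<close> as
  value, the first branch will measure how often the threshold is exceeded, the second the truncated
  second moment. The constant \<open>K\<close> absorbs rounding to integers, and the factor 2 comes
  from adding the bounds for the two branches.\<close>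

lemma sum_geometric_truncated:
  fixes r K w :: real and b :: "nat \<Rightarrow> real"
  assumes r: "r > 1" and w: "w \<ge> 0" and b: "\<And>k. r ^ k \<le> b k" "\<And>k. b k \<le> K * r ^ k"
  shows "(\<Sum>k<N. if b k < w then b k else w\<^sup>2 / b k) \<le> 2 * K * (r / (r - 1)) * w"
proof -
  have "1 \<le> K" using b[of 0] by simp
  have b0: "b k > 0" for k using less_le_trans[OF _ b(1)] r by simp
  show ?thesis
  proof (cases "w = 0")
    case True
    then show ?thesis using less_imp_le[OF b0] by (auto simp: not_less[symmetric])
  next
    case False
    then have w: "w > 0" using w by simp
    \<comment> \<open>Each branch is compared with pure powers: \<open>b k < w\<close> forces
      \<open>r ^ k < w\<close>, and its negation forces \<open>w / K \<le> r ^ k\<close>.\<close>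
    have "(if b k < w then b k else w\<^sup>2 / b k) \<le>
        K * (if r ^ k < w then r ^ k else 0) + w\<^sup>2 * (if w / K \<le> r ^ k then 1 / r ^ k else 0)" for k
    proof (cases "b k < w")
      case True
      moreover have "0 \<le> w\<^sup>2 / r ^ k" using r by simp
      ultimately show ?thesis using b[of k] r by (auto intro: order_trans)
    next
      case False
      then have "w / K \<le> r ^ k"
        using b(2)[of k] \<open>1 \<le> K\<close> by (simp add: field_simps)
      moreover have "w\<^sup>2 / b k \<le> w\<^sup>2 * (1 / r ^ k)"
        using b(1)[of k] r by (auto intro!: divide_left_mono simp: b0)
      moreover have "0 \<le> K * r ^ k" using \<open>1 \<le> K\<close> r by simp
      ultimately show ?thesis using False by auto
    qed
    then have "(\<Sum>k<N. if b k < w then b k else w\<^sup>2 / b k) \<le>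
        K * (\<Sum>k<N. if r ^ k < w then r ^ k else 0) + w\<^sup>2 * (\<Sum>k<N. if w / K \<le> r ^ k then 1 / r ^ k else 0)"
      unfolding sum_distrib_left sum.distrib[symmetric] by (intro sum_mono)
    also have "\<dots> \<le> K * (r / (r - 1) * w) + w\<^sup>2 * (r / (r - 1) / (w / K))"
      using w \<open>1 \<le> K\<close> r
      by (intro add_mono mult_left_mono sum_geometric_below sum_geometric_above) auto
    also have "\<dots> = 2 * K * (r / (r - 1)) * w"
    proof -
      have "K * (c * w) + w\<^sup>2 * (c / (w / K)) = 2 * K * c * w" for c
        using w \<open>1 \<le> K\<close> by (simp add: field_simps power2_eq_square)
      then show ?thesis .
    qed
    finally show ?thesis .
  qed
qed

text \<open>The extended form allows \<open>w\<close> to be a conditional mean, which may be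
  infinite at some points; there the right side is infinite too, because its constant is
  positive.\<close>

lemma suminf_geometric_truncated:
  fixes r K :: real and b :: "nat \<Rightarrow> real" and w :: ennreal
  assumes r: "r > 1" and b: "\<And>k. r ^ k \<le> b k" "\<And>k. b k \<le> K * r ^ k"
  shows "(\<Sum>k. if ennreal (b k) < w then ennreal (b k) else w\<^sup>2 / ennreal (b k)) \<le>
    ennreal (2 * K * (r / (r - 1))) * w"
proof -
  have "1 \<le> K" using b[of 0] by simp
  have b0: "b k > 0" for k using less_le_trans[OF _ b(1)] r by simp
  show ?thesis
  proof (cases w)
    case (real v)
    have eq: "(if ennreal (b k) < w then ennreal (b k) else w\<^sup>2 / ennreal (b k)) =
        ennreal (if b k < v then b k else v\<^sup>2 / b k)" for k
      using b0[of k] real by (simp add: ennreal_less_iff divide_ennreal ennreal_power)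
    show ?thesis
      unfolding eq
    proof (rule suminf_le_const)
      fix N
      have "(\<Sum>k<N. ennreal (if b k < v then b k else v\<^sup>2 / b k)) =
          ennreal (\<Sum>k<N. if b k < v then b k else v\<^sup>2 / b k)"
        using less_imp_le[OF b0] by (intro sum_ennreal) auto
      also have "\<dots> \<le> ennreal (2 * K * (r / (r - 1)) * v)"
        using real by (intro ennreal_leI sum_geometric_truncated r b) auto
      also have "\<dots> = ennreal (2 * K * (r / (r - 1))) * w"
        using real r \<open>1 \<le> K\<close> by (subst ennreal_mult) auto
      finally show "(\<Sum>k<N. ennreal (if b k < v then b k else v\<^sup>2 / b k)) \<le>
          ennreal (2 * K * (r / (r - 1))) * w" .
    qed simp
  next
    case top
    then show ?thesis using r \<open>1 \<le> K\<close> by (simp add: ennreal_mult_top zero_less_divide_iff)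
  qed
qed

lemma ceiling_power_bounds:
  fixes \<alpha> :: real
  assumes "\<alpha> \<ge> 1"
  shows "\<alpha> ^ k \<le> real (nat \<lceil>\<alpha> ^ k\<rceil>)" "real (nat \<lceil>\<alpha> ^ k\<rceil>) \<le> \<alpha> ^ k + 1" "real (nat \<lceil>\<alpha> ^ k\<rceil>) \<le> 2 * \<alpha> ^ k"
proof -
  have "1 \<le> \<alpha> ^ k" using assms by simp
  then show "\<alpha> ^ k \<le> real (nat \<lceil>\<alpha> ^ k\<rceil>)" "real (nat \<lceil>\<alpha> ^ k\<rceil>) \<le> \<alpha> ^ k + 1"
      "real (nat \<lceil>\<alpha> ^ k\<rceil>) \<le> 2 * \<alpha> ^ k"
    by linarith+
qed

text \<open>Between consecutive subsequence points monotonicity traps \<open>a n\<close>, and for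
  large k those points differ by a factor of at most the square of the ratio. The quotient is thus
  trapped up to \<open>\<alpha> ^ (2 * d)\<close>, which tends to 1 with the ratio. Using only the
  ratios \<open>1 + 1 / real (Suc m)\<close> keeps the family countable, so that almost sure
  statements can be combined.\<close>

lemma tendsto_if_tendsto_geometric_subsequences:
  fixes a :: "nat \<Rightarrow> real" and L :: real
  assumes a: "mono a" "\<And>n. a n \<ge> 0"
    and lim: "\<And>m::nat. (\<lambda>k. a (nat \<lceil>(1 + 1 / real (Suc m)) ^ k\<rceil>) /
      real (nat \<lceil>(1 + 1 / real (Suc m)) ^ k\<rceil>) ^ d) \<longlonglongrightarrow> L"
  shows "(\<lambda>n. a n / real n ^ d) \<longlonglongrightarrow> L"
proof -
  have bounds: "\<forall>\<^sub>F n in sequentially. (L - \<epsilon>) / \<alpha> ^ (2 * d) \<le> a n / real n ^ d \<and> a n / real n ^ d \<le> \<alpha> ^ (2 * d) * (L + \<epsilon>)"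
    if \<alpha>: "\<alpha> > 1" and lim: "(\<lambda>k. a (nat \<lceil>\<alpha> ^ k\<rceil>) / real (nat \<lceil>\<alpha> ^ k\<rceil>) ^ d) \<longlonglongrightarrow> L"
      and \<epsilon>: "\<epsilon> > 0" for \<alpha> \<epsilon> :: real
  proof -
    define s where "s k = nat \<lceil>\<alpha> ^ k\<rceil>" for k
    have s: "\<alpha> ^ k \<le> real (s k)" "real (s k) \<le> \<alpha> ^ k + 1" for k
      using ceiling_power_bounds[of \<alpha> k] \<alpha> by (auto simp: s_def)
    have s0: "real (s k) > 0" for k
      using \<alpha> by (intro less_le_trans[OF _ s(1)]) simp
    have "L \<ge> 0"
      using lim by (rule LIMSEQ_le_const) (auto intro!: exI[of _ 0] divide_nonneg_nonneg a)
    have "\<forall>\<^sub>F k in sequentially. \<bar>a (s k) / real (s k) ^ d - L\<bar> < \<epsilon>"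
      using lim \<epsilon> unfolding tendsto_iff dist_real_def s_def by auto
    \<comment> \<open>Rounding up adds at most 1, and from this point on that 1 is absorbed by one
      more factor \<open>\<alpha>\<close>.\<close>
    moreover have "\<forall>\<^sub>F k in sequentially. 1 / (\<alpha> - 1) \<le> \<alpha> ^ k"
      using filterlim_realpow_sequentially_gt1[of \<alpha>] \<alpha>
      by (intro eventually_compose_filterlim[OF eventually_ge_at_top]) (auto simp: filterlim_at_infinity_imp_filterlim_at_top)
    ultimately have "\<forall>\<^sub>F k in sequentially. \<bar>a (s k) / real (s k) ^ d - L\<bar> < \<epsilon> \<and> 1 / (\<alpha> - 1) \<le> \<alpha> ^ k"
      by eventually_elim simp
    then obtain k0 where k0: "\<And>k. k \<ge> k0 \<Longrightarrow> \<bar>a (s k) / real (s k) ^ d - L\<bar> < \<epsilon> \<and> 1 / (\<alpha> - 1) \<le> \<alpha> ^ k"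
      by (auto simp: eventually_sequentially)
    show ?thesis
      using eventually_ge_at_top[of "s k0"]
    proof eventually_elim
      case (elim n)
      obtain k' where "real n < \<alpha> ^ k'"
        using real_arch_pow \<alpha> by blast
      then have "\<exists>k. \<not> s k \<le> n"
        using s(1)[of k'] by (intro exI[of _ k']) linarith
      \<comment> \<open>\<open>k1\<close> is the first index whose subsequence point exceeds n. It
        is positive and its predecessor is at least \<open>k0\<close>, so the estimates chosen at
        \<open>k0\<close> hold at both points surrounding n.\<close>
      then obtain k1 where k1: "\<not> s k1 \<le> n" "\<And>k. k < k1 \<Longrightarrow> s k \<le> n"
        using exists_least_iff[of "\<lambda>k. \<not> s k \<le> n"] by blast
      have "k0 < k1"
      proof (rule ccontr)
        assume "\<not> k0 < k1"
        then have "\<alpha> ^ k1 \<le> \<alpha> ^ k0" using \<alpha> by (intro power_increasing) auto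
        then have "s k1 \<le> s k0" unfolding s_def by (intro nat_mono ceiling_mono)
        then show False using k1(1) elim by simp
      qed
      then obtain k where k: "k1 = Suc k" "k0 \<le> k" by (cases k1) auto
      have n: "s k \<le> n" "n \<le> s (Suc k)" using k1 k by auto
      then have n0: "real n > 0" using s0[of k] by simp
      have "1 / (\<alpha> - 1) \<le> \<alpha> ^ Suc k" using k0[of "Suc k"] k by simp
      then have "1 \<le> (\<alpha> - 1) * \<alpha> ^ Suc k" using \<alpha> by (simp add: field_simps)
      then have "\<alpha> ^ Suc k + 1 \<le> \<alpha>\<^sup>2 * \<alpha> ^ k" by (simp add: algebra_simps power2_eq_square)
      then have "real (s (Suc k)) \<le> \<alpha>\<^sup>2 * real (s k)"
        using s(2)[of "Suc k"] mult_left_mono[OF s(1)[of k], of "\<alpha>\<^sup>2"] by simp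
      then have ratio: "real (s (Suc k)) ^ d \<le> \<alpha> ^ (2 * d) * real (s k) ^ d"
        using power_mono[of "real (s (Suc k))" "\<alpha>\<^sup>2 * real (s k)" d] by (simp add: power_mult power_mult_distrib)
      have pos: "real n ^ d > 0" "real (s k) ^ d > 0" "real (s (Suc k)) ^ d > 0" "\<alpha> ^ (2 * d) > 0"
        using n0 s0 \<alpha> by simp_all
      have np: "real (s k) ^ d \<le> real n ^ d" "real n ^ d \<le> real (s (Suc k)) ^ d"
        using n by (auto intro!: power_mono)
      have amono: "a (s k) \<le> a n" "a n \<le> a (s (Suc k))"
        using n a(1) by (auto dest: monoD)
      have "a n / real n ^ d \<le> a (s (Suc k)) / real (s k) ^ d"
        using amono np pos a(2) by (intro frac_le) auto
      also have "\<dots> \<le> a (s (Suc k)) / (real (s (Suc k)) ^ d / \<alpha> ^ (2 * d))"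
        using ratio pos a(2) by (intro divide_left_mono) (auto simp: field_simps)
      also have "\<dots> = \<alpha> ^ (2 * d) * (a (s (Suc k)) / real (s (Suc k)) ^ d)" by simp
      also have "\<dots> \<le> \<alpha> ^ (2 * d) * (L + \<epsilon>)"
        using k0[of "Suc k"] k pos by (intro mult_left_mono) auto
      finally have upper: "a n / real n ^ d \<le> \<alpha> ^ (2 * d) * (L + \<epsilon>)" .
      have "(L - \<epsilon>) / \<alpha> ^ (2 * d) \<le> (a (s k) / real (s k) ^ d) / \<alpha> ^ (2 * d)"
        using k0[of k] k pos by (intro divide_right_mono) auto
      also have "\<dots> = a (s k) / (\<alpha> ^ (2 * d) * real (s k) ^ d)" by simp
      also have "\<dots> \<le> a n / real n ^ d"
        using amono np ratio pos a(2) by (intro frac_le) auto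
      finally show ?case using upper by simp
    qed
  qed
  define \<alpha> where "\<alpha> m = 1 + 1 / real (Suc m)" for m
  have \<alpha>: "\<alpha> \<longlonglongrightarrow> 1 + 0"
    unfolding \<alpha>_def by (intro tendsto_add tendsto_const LIMSEQ_Suc[OF lim_1_over_n])
  \<comment> \<open>Choosing \<open>\<epsilon>\<close> as \<open>\<alpha> m - 1\<close> lets the
    single parameter m drive both bounds to \<open>L\<close>.\<close>
  have lo: "(\<lambda>m. (L - (\<alpha> m - 1)) / \<alpha> m ^ (2 * d)) \<longlonglongrightarrow> (L - (1 + 0 - 1)) / (1 + 0) ^ (2 * d)"
    by (intro tendsto_intros \<alpha>) simp
  have hi: "(\<lambda>m. \<alpha> m ^ (2 * d) * (L + (\<alpha> m - 1))) \<longlonglongrightarrow> (1 + 0) ^ (2 * d) * (L + (1 + 0 - 1))"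
    by (intro tendsto_intros \<alpha>)
  have am: "\<alpha> m > 1" "(\<lambda>k. a (nat \<lceil>\<alpha> m ^ k\<rceil>) / real (nat \<lceil>\<alpha> m ^ k\<rceil>) ^ d) \<longlonglongrightarrow> L" "\<alpha> m - 1 > 0" for m
    unfolding \<alpha>_def by (simp, rule lim, simp)
  show ?thesis
  proof (rule order_tendstoI)
    fix l assume "l < L"
    then have "\<forall>\<^sub>F m in sequentially. l < (L - (\<alpha> m - 1)) / \<alpha> m ^ (2 * d)"
      using lo by (intro order_tendstoD) simp_all
    then obtain m where "l < (L - (\<alpha> m - 1)) / \<alpha> m ^ (2 * d)"
      by (auto simp: eventually_sequentially)
    with bounds[OF am, of m m] show "\<forall>\<^sub>F n in sequentially. l < a n / real n ^ d"
      by (auto elim!: eventually_mono)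
  next
    fix l assume "L < l"
    then have "\<forall>\<^sub>F m in sequentially. \<alpha> m ^ (2 * d) * (L + (\<alpha> m - 1)) < l"
      using hi by (intro order_tendstoD) simp_all
    then obtain m where "\<alpha> m ^ (2 * d) * (L + (\<alpha> m - 1)) < l"
      by (auto simp: eventually_sequentially)
    with bounds[OF am, of m m] show "\<forall>\<^sub>F n in sequentially. a n / real n ^ d < l"
      by (auto elim!: eventually_mono)
  qed
qed

subsection \<open>Increasing index tuples\<close>

text \<open>Up to \<open>fact d\<close>, the quotient is a product of d factors
  \<open>1 - i / n\<close>, each tending to 1.\<close>

lemma binomial_asymptotic:
  "(\<lambda>n. real (n choose d) / real n ^ d) \<longlonglongrightarrow> 1 / fact d"
proof -
  have lim: "(\<lambda>n. (\<Prod>i<d. 1 - real i * (1 / real n))) \<longlonglongrightarrow> (\<Prod>i<d. 1 - real i * 0)"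
    by (intro tendsto_intros lim_1_over_n)
  have "\<forall>\<^sub>F n in sequentially. (\<Prod>i<d. 1 - real i * (1 / real n)) / fact d = real (n choose d) / real n ^ d"
    using eventually_gt_at_top[of 0]
  proof eventually_elim
    case (elim n)
    have "real (n choose d) = (\<Prod>i<d. real n - real i) / fact d"
      by (simp add: binomial_gbinomial gbinomial_prod_rev lessThan_atLeast0)
    moreover have "(\<Prod>i<d. real n - real i) / real n ^ d = (\<Prod>i<d. 1 - real i * (1 / real n))"
    proof -
      have "(\<Prod>i<d. real n - real i) / real n ^ d = (\<Prod>i<d. (real n - real i) / real n)"
        by (simp only: prod_dividef prod_constant card_lessThan)
      also have "\<dots> = (\<Prod>i<d. 1 - real i * (1 / real n))"
        using elim by (intro prod.cong) (auto simp: diff_divide_distrib)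
      finally show ?thesis .
    qed
    ultimately show ?case by (simp add: field_simps)
  qed
  then show ?thesis
    using Lim_transform_eventually[OF tendsto_divide[OF lim tendsto_const[of "fact d"]]] by simp
qed

lemma finite_index_tuples [simp]: "finite (index_tuples d n)"
  by (rule finite_subset[of _ "{1..d} \<rightarrow>\<^sub>E {1..n}"]) (auto simp: index_tuples_def finite_PiE)

lemma index_tuples_mono: "m \<le> n \<Longrightarrow> index_tuples d m \<subseteq> index_tuples d n"
  by (auto simp: index_tuples_def PiE_iff)

lemma index_tuples_inj: "i \<in> index_tuples d n \<Longrightarrow> inj_on i {1..d}"
  by (simp add: index_tuples_def strict_mono_on_imp_inj_on)

lemma index_tuples_image: "i \<in> index_tuples d n \<Longrightarrow> i ` {1..d} \<subseteq> {1..n}"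
  by (auto simp: index_tuples_def PiE_iff)

text \<open>An increasing tuple is the sorted enumeration of its image, so such tuples correspond to
  the subsets with d elements.\<close>

lemma card_index_tuples: "card (index_tuples d n) = n choose d"
proof -
  let ?B = "{B. B \<subseteq> {1..n} \<and> card B = d}"
  have list: "map i [1..<Suc d] = sorted_list_of_set (i ` {1..d})" if "i \<in> index_tuples d n" for i
  proof -
    have "sorted_wrt (<) (map i [1..<Suc d])"
      unfolding sorted_wrt_map
      by (rule sorted_wrt_mono_rel[OF _ sorted_wrt_upt])
         (use that in \<open>auto simp: index_tuples_def strict_mono_on_def simp del: upt_Suc\<close>)
    moreover have "set (map i [1..<Suc d]) = i ` {1..d}" by auto
    moreover have "length (map i [1..<Suc d]) = card (i ` {1..d})"
      using card_image[OF index_tuples_inj[OF that]] by simp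
    ultimately show ?thesis
      using sorted_list_of_set_unique[of "i ` {1..d}"] by (metis finite_atLeastAtMost finite_imageI)
  qed
  have "bij_betw (\<lambda>i. i ` {1..d}) (index_tuples d n) ?B"
  proof (intro bij_betw_imageI inj_onI)
    fix i j assume i: "i \<in> index_tuples d n" and j: "j \<in> index_tuples d n" and eq: "i ` {1..d} = j ` {1..d}"
    have "map i [1..<Suc d] = map j [1..<Suc d]"
      by (simp only: list[OF i] list[OF j] eq)
    then have "i k = j k" if "k \<in> {1..d}" for k
      using that by (auto simp: map_eq_conv simp del: upt_Suc)
    then show "i = j"
      using i j by (intro PiE_ext[of i "{1..d}" "\<lambda>_. {1..n}" j]) (simp_all add: index_tuples_def)
  next
    show "(\<lambda>i. i ` {1..d}) ` index_tuples d n = ?B"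
    proof (intro equalityI subsetI)
      fix B assume "B \<in> (\<lambda>i. i ` {1..d}) ` index_tuples d n"
      then show "B \<in> ?B"
        using card_image[OF index_tuples_inj] index_tuples_image by fastforce
    next
      fix B assume B: "B \<in> ?B"
      then have fin: "finite B" using finite_subset by auto
      define l where "l = sorted_list_of_set B"
      have l: "sorted_wrt (<) l" "set l = B" "length l = d"
        using fin B by (auto simp: l_def)
      \<comment> \<open>Tuple positions start at 1 and list positions at 0, hence the shift.\<close>
      define i where "i = (\<lambda>k\<in>{1..d}. l ! (k - 1))"
      have img: "i ` {1..d} = B"
      proof -
        have "i ` {1..d} = (\<lambda>k. l ! (k - 1)) ` Suc ` {..<d}"
          unfolding i_def by (simp add: image_Suc_lessThan)
        also have "\<dots> = B" using l by (auto simp: image_image set_conv_nth)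
        finally show ?thesis .
      qed
      moreover have "i \<in> index_tuples d n"
        using img B l by (auto simp: index_tuples_def PiE_iff i_def strict_mono_on_def
            intro!: sorted_wrt_nth_less[OF l(1)])
      ultimately show "B \<in> (\<lambda>i. i ` {1..d}) ` index_tuples d n" by blast
    qed
  qed
  then show ?thesis
    using bij_betw_same_card n_subsets[of "{1..n}" d] by fastforce
qed

subsection \<open>Truncation of a nonnegative kernel\<close>

text \<open>The square of the larger factor already dominates the product. This separates the two
  conditional means of an overlapping pair, in place of the Cauchy-Schwarz inequality.\<close>

lemma ennreal_mult_le_squares: "a * b \<le> a\<^sup>2 + b\<^sup>2" for a b :: ennreal
proof (cases "a \<le> b")
  case True
  then have "a * b \<le> b\<^sup>2" by (simp add: power2_eq_square mult_right_mono)
  then show ?thesis by (simp add: add_increasing)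
next
  case False
  then have "a * b \<le> a\<^sup>2" by (simp add: power2_eq_square mult_left_mono)
  then show ?thesis by (simp add: add_increasing2)
qed

text \<open>Here \<open>M\<close> is the law of a single variable, and the sample space is the
  infinite product \<open>Q\<close> with its coordinates as the sequence. Nonnegativity holds at
  every point, which makes partial sums monotone and allows integration in
  \<open>ennreal\<close>.\<close>

locale integrable_kernel = prob_space +
  fixes D :: "'k set" and f :: "('k \<Rightarrow> 'a) \<Rightarrow> real"
  assumes finite_D: "finite D" and D_nonempty: "D \<noteq> {}"
    and integrable_f: "integrable (PiM D (\<lambda>_. M)) f"
    and f_nonneg: "0 \<le> f x"
begin

abbreviation "QD \<equiv> PiM D (\<lambda>_. M)"
abbreviation "Q \<equiv> PiM {1::nat..} (\<lambda>_. M)"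
abbreviation "pull i x \<equiv> (\<lambda>k\<in>D. x (i k))"
abbreviation "parts \<equiv> Pow D - {{}}"

text \<open>The estimates are made for arbitrary subfamilies \<open>T\<close> of these injective
  tuples; the increasing ones are a special case.\<close>

definition tuples :: "nat \<Rightarrow> ('k \<Rightarrow> nat) set" where
  "tuples n = {i \<in> D \<rightarrow>\<^sub>E {1..n}. inj_on i D}"

definition G :: "'k set \<Rightarrow> ('k \<Rightarrow> 'a) \<Rightarrow> ennreal" where
  "G A = cond_mean D A (\<lambda>x. ennreal (f x))"

text \<open>About \<open>n ^ card A\<close> values \<open>G A\<close> enter the sum at stage \<open>n\<close>. At the threshold \<open>n ^ card A\<close>, both
  the chance that some value is cut off and the second moment that remains are summable along
  geometric \<open>n\<close>, assuming only a first moment.\<close>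

definition trunc :: "nat \<Rightarrow> ('k \<Rightarrow> 'a) \<Rightarrow> real" where
  "trunc n x = (if \<forall>A\<in>parts. G A x \<le> ennreal (real n ^ card A) then f x else 0)"

definition G_trunc :: "'k set \<Rightarrow> nat \<Rightarrow> ('k \<Rightarrow> 'a) \<Rightarrow> ennreal" where
  "G_trunc A n x = (if G A x \<le> ennreal (real n ^ card A) then G A x else 0)"

lemma measurable_f [measurable]: "f \<in> borel_measurable QD"
  using integrable_f by simp

lemma measurable_G [measurable]: "G A \<in> borel_measurable QD"
  unfolding G_def by simp

lemma finite_parts: "finite parts"
  using finite_D by simp

lemma measurable_trunc [measurable]: "trunc n \<in> borel_measurable QD"
proof -
  have [measurable]: "Measurable.pred QD (\<lambda>x. \<forall>A\<in>parts. G A x \<le> ennreal (real n ^ card A))"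
    by (intro pred_intros_finite finite_parts) measurable
  show ?thesis
    unfolding trunc_def[abs_def] by measurable
qed

lemma measurable_G_trunc [measurable]: "G_trunc A n \<in> borel_measurable QD"
  unfolding G_trunc_def[abs_def] by measurable

lemma prob_space_QD: "prob_space QD" and prob_space_Q: "prob_space Q"
  by (rule prob_space_PiM, rule prob_space_axioms)+

lemma measurable_pull [measurable]:
  assumes "i \<in> tuples n"
  shows "(\<lambda>x. pull i x) \<in> Q \<rightarrow>\<^sub>M QD"
  using assms by (intro measurable_restrict measurable_component_singleton) (auto simp: tuples_def PiE_iff)

lemma nn_integral_pull:
  assumes "i \<in> tuples n" "H \<in> borel_measurable QD"
  shows "(\<integral>\<^sup>+x. H (pull i x) \<partial>Q) = (\<integral>\<^sup>+x. H x \<partial>QD)"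
  using assms by (intro nn_integral_PiM_reindex) (auto simp: tuples_def PiE_iff)

lemma trunc_nonneg: "0 \<le> trunc n x" and trunc_le: "trunc n x \<le> f x"
  using f_nonneg by (auto simp: trunc_def)

lemma trunc_eq: "(\<And>A. A \<in> parts \<Longrightarrow> G A x \<le> ennreal (real n ^ card A)) \<Longrightarrow> trunc n x = f x"
  unfolding trunc_def by (simp del: Diff_iff Pow_iff)

text \<open>For \<open>A = D\<close> nothing is resampled, so \<open>G D\<close> is \<open>f\<close>
  itself on the space, and its threshold is \<open>n ^ card D\<close>.\<close>

lemma trunc_bounded:
  assumes "x \<in> space QD"
  shows "trunc n x \<le> real n ^ card D"
proof -
  interpret QD: prob_space QD by (rule prob_space_QD)
  have "G D x = (\<integral>\<^sup>+y. ennreal (f x) \<partial>QD)"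
    unfolding G_def cond_mean_def using assms
    by (intro nn_integral_cong arg_cong[where f = "\<lambda>x. ennreal (f x)"])
       (auto simp: override_on_def space_PiM PiE_iff extensional_def fun_eq_iff)
  also have "\<dots> = ennreal (f x)"
    by (simp add: QD.emeasure_space_1)
  finally show ?thesis
    using D_nonempty f_nonneg[of x] bspec[of parts "\<lambda>A. G A x \<le> ennreal (real n ^ card A)" D]
    by (simp add: trunc_def)
qed

lemma nn_integral_G: "(\<integral>\<^sup>+x. G A x \<partial>QD) = ennreal (\<integral>x. f x \<partial>QD)"
  unfolding G_def by (simp add: nn_integral_cond_mean nn_integral_eq_integral[OF integrable_f] f_nonneg)

text \<open>The condition on \<open>G A\<close> sees only coordinates in \<open>A\<close>, so it is
  constant while the others are integrated. If it fails, the truncated kernel vanishes on the whole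
  fibre; otherwise that kernel is at most \<open>f\<close>.\<close>

lemma cond_mean_trunc_le:
  assumes "A \<in> parts"
  shows "cond_mean D A (\<lambda>x. ennreal (trunc n x)) x \<le> G_trunc A n x"
proof -
  have "ennreal (trunc n (override_on y x A)) \<le>
      (if G A x \<le> ennreal (real n ^ card A) then ennreal (f (override_on y x A)) else 0)" for y
  proof -
    have "G A (override_on y x A) = G A x"
      unfolding G_def by (rule cond_mean_cong) simp
    with assms have "trunc n (override_on y x A) = 0" if "\<not> G A x \<le> ennreal (real n ^ card A)"
      using that unfolding trunc_def by (metis (no_types, lifting))
    then show ?thesis
      using trunc_le by (simp add: ennreal_leI)
  qed
  then have "cond_mean D A (\<lambda>x. ennreal (trunc n x)) x \<le>
      (\<integral>\<^sup>+y. (if G A x \<le> ennreal (real n ^ card A) then ennreal (f (override_on y x A)) else 0) \<partial>QD)"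
    unfolding cond_mean_def by (intro nn_integral_mono)
  also have "\<dots> = G_trunc A n x"
    by (simp add: G_trunc_def G_def cond_mean_def)
  finally show ?thesis .
qed

section \<open>Moments of the truncated sum and the counting of overlaps\<close>

definition "mean n = (\<integral>x. trunc n x \<partial>QD)"

lemma integrable_trunc: "integrable QD (trunc n)"
  by (rule Bochner_Integration.integrable_bound[OF integrable_f])
     (auto simp: trunc_nonneg f_nonneg trunc_le)

lemma nn_integral_trunc: "(\<integral>\<^sup>+x. ennreal (trunc n x) \<partial>QD) = ennreal (mean n)"
  unfolding mean_def by (intro nn_integral_eq_integral integrable_trunc) (simp add: trunc_nonneg)

lemma mean_nonneg: "0 \<le> mean n"
  unfolding mean_def by (intro integral_nonneg_AE) (simp add: trunc_nonneg)

text \<open>The set consists of positions in \<open>D\<close> rather than of shared indices, because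
  conditional means are taken over positions. It is not symmetric, so both orders of a pair occur
  below.\<close>

definition overlap :: "('k \<Rightarrow> nat) \<Rightarrow> ('k \<Rightarrow> nat) \<Rightarrow> 'k set" where
  "overlap i j = {k\<in>D. i k \<in> j ` D}"

lemma overlap_eq_empty: "overlap i j = {} \<longleftrightarrow> i ` D \<inter> j ` D = {}"
  by (auto simp: overlap_def)

lemma overlap_subset: "overlap i j \<subseteq> D"
  by (auto simp: overlap_def)

text \<open>Without shared indices both conditional means are the constant \<open>mean n\<close>;
  with shared indices they are dominated by the corresponding \<open>G_trunc\<close>. Writing the
  error as a sum over all \<open>A\<close> with selectors turns summation over pairs into
  counting.\<close>

lemma nn_integral_trunc_mult:
  assumes i: "i \<in> tuples n" and j: "j \<in> tuples n"
  shows "(\<integral>\<^sup>+x. ennreal (trunc n (pull i x)) * ennreal (trunc n (pull j x)) \<partial>Q) \<le>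
    ennreal ((mean n)\<^sup>2) + (\<Sum>A\<in>parts. (of_bool (overlap i j = A) + of_bool (overlap j i = A)) * (\<integral>\<^sup>+x. (G_trunc A n x)\<^sup>2 \<partial>QD))"
    (is "?I \<le> _ + ?R")
proof -
  note [measurable] = measurable_pull[OF i] measurable_pull[OF j]
  interpret Q: prob_space Q by (rule prob_space_Q)
  let ?u = "\<lambda>x. ennreal (trunc n x)"
  have eq: "?I = (\<integral>\<^sup>+x. cond_mean D (overlap i j) ?u (pull i x) * cond_mean D (overlap j i) ?u (pull j x) \<partial>Q)"
    unfolding overlap_def using i j by (intro nn_integral_overlap) (auto simp: tuples_def PiE_iff)
  show ?thesis
  proof (cases "overlap i j = {}")
    case True
    then have "overlap j i = {}" by (auto simp: overlap_eq_empty)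
    with True have "?I = ennreal (mean n) * ennreal (mean n)"
      unfolding eq by (simp add: cond_mean_def nn_integral_trunc Q.emeasure_space_1 del: One_nat_def)
    then show ?thesis
      by (simp add: power2_eq_square mean_nonneg ennreal_mult add_increasing2)
  next
    case False
    then have "overlap i j \<noteq> {}" "overlap j i \<noteq> {}"
      unfolding overlap_eq_empty by auto
    then have ne: "overlap i j \<in> parts" "overlap j i \<in> parts"
      using overlap_subset by auto
    have "?I \<le> (\<integral>\<^sup>+x. (G_trunc (overlap i j) n (pull i x))\<^sup>2 + (G_trunc (overlap j i) n (pull j x))\<^sup>2 \<partial>Q)"
      unfolding eq
      by (intro nn_integral_mono order_trans[OF _ ennreal_mult_le_squares] mult_mono cond_mean_trunc_le ne) auto
    also have "\<dots> = (\<integral>\<^sup>+x. (G_trunc (overlap i j) n (pull i x))\<^sup>2 \<partial>Q) + (\<integral>\<^sup>+x. (G_trunc (overlap j i) n (pull j x))\<^sup>2 \<partial>Q)"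
      by (intro nn_integral_add) measurable
    also have "\<dots> = (\<integral>\<^sup>+x. (G_trunc (overlap i j) n x)\<^sup>2 \<partial>QD) + (\<integral>\<^sup>+x. (G_trunc (overlap j i) n x)\<^sup>2 \<partial>QD)"
      by (subst nn_integral_pull[OF i, of "\<lambda>x. (G_trunc (overlap i j) n x)\<^sup>2"],
          measurable, subst nn_integral_pull[OF j, of "\<lambda>x. (G_trunc (overlap j i) n x)\<^sup>2"], measurable)
    also have "\<dots> = ?R"
      using ne finite_parts by (simp add: distrib_right sum.distrib of_bool_def if_distrib[where f = "\<lambda>x. x * _"]
          sum.delta cong: if_cong)
    finally show ?thesis by (simp add: add_increasing)
  qed
qed

lemma finite_tuples: "finite (tuples n)"
  by (rule finite_subset[of _ "D \<rightarrow>\<^sub>E {1..n}"]) (auto simp: tuples_def finite_PiE finite_D)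

text \<open>A position in \<open>A\<close> must take one of at most \<open>card D\<close> indices of
  \<open>j\<close>; every other position has at most n choices.\<close>

lemma card_overlap:
  assumes "A \<in> parts"
  shows "card {i \<in> tuples n. overlap i j = A} \<le> card D ^ card A * n ^ (card D - card A)"
proof -
  have "card {i \<in> tuples n. overlap i j = A} \<le> card (\<Pi>\<^sub>E k\<in>D. if k \<in> A then j ` D else {1..n})"
  proof (intro card_mono finite_PiE subsetI)
    fix i assume "i \<in> {i \<in> tuples n. overlap i j = A}"
    then have "i \<in> D \<rightarrow>\<^sub>E {1..n}" "A = {k\<in>D. i k \<in> j ` D}"
      by (simp_all add: tuples_def overlap_def)
    then show "i \<in> (\<Pi>\<^sub>E k\<in>D. if k \<in> A then j ` D else {1..n})"
      by (simp add: PiE_iff)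
  qed (simp_all add: finite_D)
  also have "\<dots> = (\<Prod>k\<in>D. if k \<in> A then card (j ` D) else n)"
    by (subst card_PiE) (auto simp: finite_D intro!: prod.cong)
  also have "\<dots> = card (j ` D) ^ card A * n ^ (card D - card A)"
  proof -
    have "A \<subseteq> D" "finite A" using assms finite_D finite_subset by blast+
    then show ?thesis
      using finite_D by (simp add: prod.If_cases Int_absorb1 card_Diff_subset Diff_eq[symmetric])
  qed
  also have "\<dots> \<le> card D ^ card A * n ^ (card D - card A)"
    by (intro mult_right_mono power_mono card_image_le finite_D) auto
  finally show ?thesis .
qed

lemma card_tuples_le: "card (tuples n) \<le> n ^ card D"
proof -
  have "card (tuples n) \<le> card (D \<rightarrow>\<^sub>E {1..n})"
    by (intro card_mono finite_PiE) (auto simp: finite_D tuples_def)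
  then show ?thesis by (simp add: card_PiE finite_D)
qed

lemma card_overlapping_pairs:
  assumes T: "T \<subseteq> tuples n" and A: "A \<in> parts"
  shows "(\<Sum>i\<in>T. \<Sum>j\<in>T. of_bool (overlap i j = A)) \<le> n ^ card D * (card D ^ card A * n ^ (card D - card A))"
proof -
  have fin: "finite T" using T finite_tuples finite_subset by auto
  have "(\<Sum>i\<in>T. \<Sum>j\<in>T. of_bool (overlap i j = A)) = (\<Sum>j\<in>T. card {i\<in>T. overlap i j = A})"
    by (subst sum.swap) (simp add: sum_of_bool_eq fin Collect_conj_eq Int_commute)
  also have "\<dots> \<le> (\<Sum>j\<in>T. card D ^ card A * n ^ (card D - card A))"
    by (intro sum_mono order_trans[OF card_mono card_overlap[OF A]]) (use T finite_tuples in auto)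
  also have "\<dots> \<le> n ^ card D * (card D ^ card A * n ^ (card D - card A))"
    using order_trans[OF card_mono[OF finite_tuples T] card_tuples_le]
    by (simp add: mult_right_mono)
  finally show ?thesis .
qed

text \<open>The term \<open>(mean n)\<^sup>2\<close> is charged to every pair, overlapping or not.
  It adds up to exactly the square of the expected sum, so the remaining terms bound the
  variance.\<close>

lemma second_moment:
  assumes T: "T \<subseteq> tuples n"
  shows "(\<integral>\<^sup>+x. (\<Sum>i\<in>T. ennreal (trunc n (pull i x)))\<^sup>2 \<partial>Q) \<le>
    ennreal ((real (card T) * mean n)\<^sup>2) +
    (\<Sum>A\<in>parts. of_nat (2 * (n ^ card D * (card D ^ card A * n ^ (card D - card A)))) * (\<integral>\<^sup>+x. (G_trunc A n x)\<^sup>2 \<partial>QD))"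
proof -
  let ?H = "\<lambda>A. (\<integral>\<^sup>+x. (G_trunc A n x)\<^sup>2 \<partial>QD)"
  have [measurable]: "(\<lambda>x. pull i x) \<in> Q \<rightarrow>\<^sub>M QD" if "i \<in> T" for i
    using that T measurable_pull by auto
  have "(\<integral>\<^sup>+x. (\<Sum>i\<in>T. ennreal (trunc n (pull i x)))\<^sup>2 \<partial>Q) =
      (\<integral>\<^sup>+x. (\<Sum>i\<in>T. \<Sum>j\<in>T. ennreal (trunc n (pull i x)) * ennreal (trunc n (pull j x))) \<partial>Q)"
    by (simp add: power2_eq_square sum_product)
  also have "\<dots> = (\<Sum>i\<in>T. \<Sum>j\<in>T. (\<integral>\<^sup>+x. ennreal (trunc n (pull i x)) * ennreal (trunc n (pull j x)) \<partial>Q))"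
    by (subst nn_integral_sum, measurable, intro sum.cong refl, subst nn_integral_sum, measurable)
  also have "\<dots> \<le> (\<Sum>i\<in>T. \<Sum>j\<in>T. ennreal ((mean n)\<^sup>2) +
      (\<Sum>A\<in>parts. (of_bool (overlap i j = A) + of_bool (overlap j i = A)) * ?H A))"
    using T by (intro sum_mono nn_integral_trunc_mult) auto
  also have "\<dots> = of_nat (card T) * (of_nat (card T) * ennreal ((mean n)\<^sup>2)) +
      (\<Sum>i\<in>T. \<Sum>j\<in>T. \<Sum>A\<in>parts. (of_bool (overlap i j = A) + of_bool (overlap j i = A)) * ?H A)"
    by (simp add: sum.distrib)
  also have "of_nat (card T) * (of_nat (card T) * ennreal ((mean n)\<^sup>2)) = ennreal ((real (card T) * mean n)\<^sup>2)"
    by (simp add: power_mult_distrib ennreal_mult power2_eq_square ennreal_of_nat_eq_real_of_nat mult_ac mean_nonneg)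
  also have "(\<Sum>i\<in>T. \<Sum>j\<in>T. \<Sum>A\<in>parts. (of_bool (overlap i j = A) + of_bool (overlap j i = A)) * ?H A) =
      (\<Sum>A\<in>parts. (\<Sum>i\<in>T. \<Sum>j\<in>T. (of_bool (overlap i j = A) + of_bool (overlap j i = A))) * ?H A)"
    unfolding sum_distrib_right
    by (subst sum.swap[of _ parts T]) (intro sum.cong refl sum.swap)
  also have "ennreal ((real (card T) * mean n)\<^sup>2) +
      (\<Sum>A\<in>parts. (\<Sum>i\<in>T. \<Sum>j\<in>T. (of_bool (overlap i j = A) + of_bool (overlap j i = A))) * ?H A) \<le>
      ennreal ((real (card T) * mean n)\<^sup>2) +
      (\<Sum>A\<in>parts. of_nat (2 * (n ^ card D * (card D ^ card A * n ^ (card D - card A)))) * ?H A)"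
  proof (intro add_left_mono sum_mono mult_right_mono)
    fix A assume A: "A \<in> parts"
    let ?c = "n ^ card D * (card D ^ card A * n ^ (card D - card A))"
    \<comment> \<open>Exchanging the two summations reduces the second selector to the first count,
      which accounts for the factor 2.\<close>
    have "(\<Sum>i\<in>T. \<Sum>j\<in>T. (of_bool (overlap i j = A) + of_bool (overlap j i = A)) :: ennreal) =
        of_nat ((\<Sum>i\<in>T. \<Sum>j\<in>T. of_bool (overlap i j = A)) + (\<Sum>j\<in>T. \<Sum>i\<in>T. of_bool (overlap i j = A)))"
      by (simp add: sum.distrib)
    also have "\<dots> \<le> of_nat (?c + ?c)"
      unfolding of_nat_le_iff
      by (intro add_mono card_overlapping_pairs[OF T A] order_trans[OF eq_refl[OF sum.swap] card_overlapping_pairs[OF T A]])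
    finally show "(\<Sum>i\<in>T. \<Sum>j\<in>T. (of_bool (overlap i j = A) + of_bool (overlap j i = A)) :: ennreal) \<le> of_nat (2 * ?c)"
      by (simp add: mult_2)
  qed simp
  finally show ?thesis .
qed

text \<open>A union bound over all of \<open>T\<close> would be too coarse. For fixed
  \<open>A\<close>, the event that \<open>G A\<close> is too large depends only on the indices at
  positions in \<open>A\<close>, so at most \<open>n ^ card A\<close> distinct events occur.\<close>

lemma emeasure_trunc_neq:
  assumes T: "T \<subseteq> tuples n"
  shows "emeasure Q {x\<in>space Q. \<exists>i\<in>T. trunc n (pull i x) \<noteq> f (pull i x)} \<le>
    (\<Sum>A\<in>parts. ennreal (real n ^ card A) * emeasure QD {x\<in>space QD. ennreal (real n ^ card A) < G A x})"
proof -
  define E where "E A i = {x\<in>space Q. ennreal (real n ^ card A) < G A (pull i x)}" for A i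
  have fin: "finite T" using T finite_tuples finite_subset by auto
  have pull [measurable]: "(\<lambda>x. pull i x) \<in> Q \<rightarrow>\<^sub>M QD" if "i \<in> T" for i
    using that T measurable_pull by auto
  have E: "E A i \<in> sets Q" if "i \<in> T" for i A
    unfolding E_def using pull[OF that] by measurable
  have EU: "\<Union> (E A ` T) \<in> sets Q" for A
    using fin E by (intro sets.finite_Union) auto
  have "emeasure Q {x\<in>space Q. \<exists>i\<in>T. trunc n (pull i x) \<noteq> f (pull i x)} \<le>
      emeasure Q (\<Union>A\<in>parts. \<Union> (E A ` T))"
  proof (rule emeasure_mono)
    show "{x\<in>space Q. \<exists>i\<in>T. trunc n (pull i x) \<noteq> f (pull i x)} \<subseteq> (\<Union>A\<in>parts. \<Union> (E A ` T))"
    proof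
      fix x assume "x \<in> {x\<in>space Q. \<exists>i\<in>T. trunc n (pull i x) \<noteq> f (pull i x)}"
      then obtain i where i: "i \<in> T" "trunc n (pull i x) \<noteq> f (pull i x)" and x: "x \<in> space Q"
        by blast
      then obtain A where "A \<in> parts" "\<not> G A (pull i x) \<le> ennreal (real n ^ card A)"
        using trunc_eq by blast
      then show "x \<in> (\<Union>A\<in>parts. \<Union> (E A ` T))"
        using x i(1) unfolding E_def not_le by blast
    qed
    show "(\<Union>A\<in>parts. \<Union> (E A ` T)) \<in> sets Q"
      by (intro sets.finite_UN finite_parts EU)
  qed
  also have "\<dots> \<le> (\<Sum>A\<in>parts. emeasure Q (\<Union> (E A ` T)))"
    using EU by (intro emeasure_subadditive_finite finite_parts) auto
  also have "\<dots> \<le> (\<Sum>A\<in>parts. ennreal (real n ^ card A) * emeasure QD {x\<in>space QD. ennreal (real n ^ card A) < G A x})"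
  proof (rule sum_mono)
    fix A assume A: "A \<in> parts"
    then have finA: "finite A" using finite_D finite_subset by blast
    let ?B = "{x\<in>space QD. ennreal (real n ^ card A) < G A x}"
    have eE: "emeasure Q (E A i) = emeasure QD ?B" if i: "i \<in> T" for i
    proof -
      have "emeasure Q (E A i) = (\<integral>\<^sup>+x. indicator (E A i) x \<partial>Q)"
        using E[OF i] by simp
      also have "\<dots> = (\<integral>\<^sup>+x. indicator ?B (pull i x) \<partial>Q)"
        using measurable_space[OF pull[OF i]]
        by (intro nn_integral_cong) (auto simp: E_def indicator_def)
      also have "\<dots> = (\<integral>\<^sup>+x. indicator ?B x \<partial>QD)"
        using i T by (intro nn_integral_pull) auto
      finally show ?thesis by simp
    qed
    \<comment> \<open>\<open>F\<close> may be applied to a tuple restricted to \<open>A\<close>,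
      whose default values elsewhere do not matter because \<open>G A\<close> ignores those
      positions. Hence the distinct events are counted by the restrictions.\<close>
    define F where "F t = {x\<in>space Q. ennreal (real n ^ card A) < G A (pull t x)}" for t
    have "E A i = F (restrict i A)" for i
    proof -
      have "G A (pull i x) = G A (pull (restrict i A) x)" for x
        unfolding G_def by (rule cond_mean_cong) (use A in auto)
      then show ?thesis
        unfolding E_def F_def by simp
    qed
    then have "E A ` T = F ` ((\<lambda>i. restrict i A) ` T)"
      by (simp add: image_image)
    then have "card (E A ` T) \<le> card ((\<lambda>i. restrict i A) ` T)"
      using fin by (simp add: card_image_le)
    also have "\<dots> \<le> card (A \<rightarrow>\<^sub>E {1..n})"
    proof (intro card_mono finite_PiE image_subsetI)
      fix i assume "i \<in> T"
      then have "i k \<in> {1..n}" if "k \<in> A" for k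
        using that T A unfolding tuples_def by blast
      then show "restrict i A \<in> A \<rightarrow>\<^sub>E {1..n}"
        by (simp add: PiE_iff)
    qed (simp_all add: finA)
    also have "\<dots> = n ^ card A"
      using finA by (simp add: card_PiE)
    finally have card: "card (E A ` T) \<le> n ^ card A" .
    have "emeasure Q (\<Union> (E A ` T)) \<le> (\<Sum>B\<in>E A ` T. emeasure Q B)"
      using emeasure_subadditive_finite[of "E A ` T" "\<lambda>B. B" Q] fin E by auto
    also have "\<dots> = of_nat (card (E A ` T)) * emeasure QD ?B"
    proof -
      have "(\<Sum>B\<in>E A ` T. emeasure Q B) = (\<Sum>B\<in>E A ` T. emeasure QD ?B)"
        using eE by (intro sum.cong) auto
      then show ?thesis by simp
    qed
    also have "\<dots> \<le> of_nat (n ^ card A) * emeasure QD ?B"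
      using card by (intro mult_right_mono) (auto simp del: of_nat_power)
    finally show "emeasure Q (\<Union> (E A ` T)) \<le> ennreal (real n ^ card A) * emeasure QD ?B"
      by (simp add: ennreal_power ennreal_of_nat_eq_real_of_nat)
  qed
  finally show ?thesis .
qed

text \<open>The centring is the exact expectation, so the left side is a variance and
  \<open>second_moment\<close> applies after subtracting the squared mean.\<close>

lemma variance_trunc:
  assumes T: "T \<subseteq> tuples n" and n: "n > 0"
  shows "(\<integral>\<^sup>+x. ennreal ((((\<Sum>i\<in>T. trunc n (pull i x)) - real (card T) * mean n) / real n ^ card D)\<^sup>2) \<partial>Q) \<le>
    (\<Sum>A\<in>parts. ennreal (2 * real (card D) ^ card A) * ((\<integral>\<^sup>+x. (G_trunc A n x)\<^sup>2 \<partial>QD) / ennreal (real n ^ card A)))"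
proof -
  interpret Q: prob_space Q by (rule prob_space_Q)
  define S where "S x = (\<Sum>i\<in>T. trunc n (pull i x))" for x
  define c where "c = real (card T) * mean n"
  let ?H = "\<lambda>A. (\<integral>\<^sup>+x. (G_trunc A n x)\<^sup>2 \<partial>QD)"
  let ?m = "\<lambda>A. n ^ card D * (card D ^ card A * n ^ (card D - card A))"
  let ?R = "\<Sum>A\<in>parts. of_nat (2 * ?m A) * ?H A"
  have pull [measurable]: "(\<lambda>x. pull i x) \<in> Q \<rightarrow>\<^sub>M QD" if "i \<in> T" for i
    using that T measurable_pull by auto
  have S [measurable]: "S \<in> borel_measurable Q"
    unfolding S_def[abs_def] by measurable
  have S_nonneg: "0 \<le> S x" for x
    unfolding S_def by (simp add: sum_nonneg trunc_nonneg)
  have S_bound: "S x \<le> real (card T) * real n ^ card D" if "x \<in> space Q" for x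
    unfolding S_def using trunc_bounded[OF measurable_space[OF pull that]] by (intro sum_bounded_above) auto
  \<comment> \<open>Boundedness from the truncation gives a finite second moment, although
    \<open>f\<close> is only assumed integrable.\<close>
  have int: "integrable Q S" "integrable Q (\<lambda>x. (S x)\<^sup>2)"
  proof -
    show "integrable Q S"
      using S_bound S_nonneg
      by (intro Q.integrable_const_bound[where B = "real (card T) * real n ^ card D"] AE_I2 S) auto
    have "(\<lambda>x. (S x)\<^sup>2) \<in> borel_measurable Q" by measurable
    then show "integrable Q (\<lambda>x. (S x)\<^sup>2)"
      using S_bound S_nonneg
      by (intro Q.integrable_const_bound[where B = "(real (card T) * real n ^ card D)\<^sup>2"] AE_I2)
         (auto intro: power_mono)
  qed
  have int': "integrable Q (\<lambda>x. (S x - c)\<^sup>2)"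
    unfolding power2_diff
    by (intro Bochner_Integration.integrable_add Bochner_Integration.integrable_diff
        integrable_mult_left integrable_mult_right int Q.integrable_const)
  have exp: "Q.expectation S = c"
  proof -
    have "ennreal (Q.expectation S) = (\<integral>\<^sup>+x. ennreal (S x) \<partial>Q)"
      by (rule nn_integral_eq_integral[symmetric]) (use int S_nonneg in simp_all)
    also have "\<dots> = (\<integral>\<^sup>+x. (\<Sum>i\<in>T. ennreal (trunc n (pull i x))) \<partial>Q)"
      by (simp add: S_def trunc_nonneg)
    also have "\<dots> = (\<Sum>i\<in>T. \<integral>\<^sup>+x. ennreal (trunc n (pull i x)) \<partial>Q)"
      by (intro nn_integral_sum) measurable
    also have "\<dots> = (\<Sum>i\<in>T. ennreal (mean n))"
      using T by (intro sum.cong refl) (subst nn_integral_pull[where H = "\<lambda>x. ennreal (trunc n x)"], auto simp: nn_integral_trunc)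
    also have "\<dots> = ennreal c"
      by (simp add: c_def ennreal_mult mean_nonneg ennreal_of_nat_eq_real_of_nat)
    finally show ?thesis
      using mean_nonneg[of n] by (subst (asm) ennreal_inj) (auto simp: c_def S_nonneg)
  qed
  have "ennreal (Q.expectation (\<lambda>x. (S x)\<^sup>2)) = (\<integral>\<^sup>+x. ennreal ((S x)\<^sup>2) \<partial>Q)"
    by (rule nn_integral_eq_integral[symmetric]) (use int in simp_all)
  also have "\<dots> = (\<integral>\<^sup>+x. (\<Sum>i\<in>T. ennreal (trunc n (pull i x)))\<^sup>2 \<partial>Q)"
    using S_nonneg by (simp add: S_def trunc_nonneg flip: ennreal_power)
  also have "\<dots> \<le> ennreal (c\<^sup>2) + ?R"
    unfolding c_def by (rule second_moment[OF T])
  finally have le: "ennreal (Q.expectation (\<lambda>x. (S x)\<^sup>2)) \<le> ennreal (c\<^sup>2) + ?R" .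
  have "(\<integral>\<^sup>+x. ennreal ((S x - c)\<^sup>2) \<partial>Q) = ennreal (Q.expectation (\<lambda>x. (S x - c)\<^sup>2))"
    by (rule nn_integral_eq_integral[OF int']) simp
  also have "\<dots> = ennreal (Q.expectation (\<lambda>x. (S x)\<^sup>2) - c\<^sup>2)"
    using Q.variance_eq[OF int] by (simp only: exp)
  also have "\<dots> = ennreal (Q.expectation (\<lambda>x. (S x)\<^sup>2)) - ennreal (c\<^sup>2)"
    by (simp add: ennreal_minus)
  also have "\<dots> \<le> ?R"
    using le by (simp add: ennreal_minus_le_iff)
  finally have var: "(\<integral>\<^sup>+x. ennreal ((S x - c)\<^sup>2) \<partial>Q) \<le> ?R" .
  let ?a = "ennreal (1 / (real n ^ card D)\<^sup>2)"
  have "(\<integral>\<^sup>+x. ennreal (((S x - c) / real n ^ card D)\<^sup>2) \<partial>Q) = (\<integral>\<^sup>+x. ?a * ennreal ((S x - c)\<^sup>2) \<partial>Q)"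
    by (simp add: power_divide flip: ennreal_mult)
  also have "\<dots> = ?a * (\<integral>\<^sup>+x. ennreal ((S x - c)\<^sup>2) \<partial>Q)"
    by (rule nn_integral_cmult) measurable
  also have "\<dots> \<le> ?a * ?R"
    by (intro mult_left_mono var) simp
  also have "\<dots> = (\<Sum>A\<in>parts. ennreal (2 * real (card D) ^ card A) * (?H A / ennreal (real n ^ card A)))"
    unfolding sum_distrib_left
  proof (intro sum.cong refl)
    fix A assume A: "A \<in> parts"
    then have cA: "card A \<le> card D" using card_mono[OF finite_D, of A] by simp
    \<comment> \<open>Of the \<open>2 * card D\<close> powers of n in the denominator, the count of
      overlapping pairs cancels all but \<open>card A\<close>.\<close>
    have "real n ^ card D = real n ^ card A * real n ^ (card D - card A)"
      using cA by (simp flip: power_add)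
    then have real: "1 / (real n ^ card D)\<^sup>2 * real (2 * ?m A) = 2 * real (card D) ^ card A * (1 / real n ^ card A)"
      using n by (simp add: field_simps power2_eq_square)
    have "?a * (of_nat (2 * ?m A) * ?H A) = ?a * ennreal (real (2 * ?m A)) * ?H A"
      by (simp only: mult.assoc ennreal_of_nat_eq_real_of_nat)
    also have "\<dots> = ennreal (1 / (real n ^ card D)\<^sup>2 * real (2 * ?m A)) * ?H A"
      by (subst ennreal_mult) simp_all
    also have "\<dots> = ennreal (2 * real (card D) ^ card A) * (?H A * ennreal (1 / real n ^ card A))"
      unfolding real by (subst ennreal_mult) (simp_all add: mult_ac)
    also have "?H A * ennreal (1 / real n ^ card A) = ?H A / ennreal (real n ^ card A)"
      using n by (simp add: divide_ennreal_def inverse_ennreal inverse_eq_divide)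
    finally show "?a * (of_nat (2 * ?m A) * ?H A) = ennreal (2 * real (card D) ^ card A) * (?H A / ennreal (real n ^ card A))" .
  qed
  finally show ?thesis by (simp add: S_def c_def)
qed

section \<open>Summability along geometric subsequences and almost sure limits\<close>

lemma suminf_G_trunc:
  fixes \<alpha> :: real
  assumes A: "A \<in> parts" and \<alpha>: "\<alpha> > 1"
  defines "s \<equiv> \<lambda>k. nat \<lceil>\<alpha> ^ k\<rceil>"
  shows "(\<Sum>k. (\<integral>\<^sup>+x. (G_trunc A (s k) x)\<^sup>2 \<partial>QD) / ennreal (real (s k) ^ card A)) < \<infinity>"
    and "(\<Sum>k. ennreal (real (s k) ^ card A) * emeasure QD {x\<in>space QD. ennreal (real (s k) ^ card A) < G A x}) < \<infinity>"
proof -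
  let ?c = "card A"
  have "finite A" "A \<noteq> {}" using A finite_D finite_subset by auto
  \<comment> \<open>Since \<open>A\<close> is nonempty, the growth ratio
    \<open>\<alpha> ^ card A\<close> of the thresholds exceeds 1, as the geometric bounds
    require.\<close>
  then have c: "?c > 0" by (simp add: card_gt_0_iff)
  define b where "b k = real (s k) ^ ?c" for k
  have b: "(\<alpha> ^ ?c) ^ k \<le> b k" "b k \<le> 2 ^ ?c * (\<alpha> ^ ?c) ^ k" for k
  proof -
    have "(\<alpha> ^ k) ^ ?c \<le> b k"
      unfolding b_def s_def using \<alpha> by (intro power_mono ceiling_power_bounds(1)) auto
    moreover have "b k \<le> (2 * \<alpha> ^ k) ^ ?c"
      unfolding b_def s_def using \<alpha> by (intro power_mono ceiling_power_bounds(3) of_nat_0_le_iff) auto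
    ultimately show "(\<alpha> ^ ?c) ^ k \<le> b k" "b k \<le> 2 ^ ?c * (\<alpha> ^ ?c) ^ k"
      by (simp_all add: power_mult_distrib mult.commute flip: power_mult)
  qed
  define K where "K = 2 * 2 ^ ?c * (\<alpha> ^ ?c / (\<alpha> ^ ?c - 1))"
  \<comment> \<open>At a point where \<open>G A\<close> has value w, a threshold below w contributes
    to the exceedance series and any other to the truncated second moment. So \<open>?t\<close>
    majorizes both summands, and after exchanging sum and integral both series are bounded by a
    multiple of the mean of \<open>G A\<close>.\<close>
  let ?t = "\<lambda>w k. if ennreal (b k) < w then ennreal (b k) else w\<^sup>2 / ennreal (b k)"
  have bound: "(\<Sum>k. ?t w k) \<le> ennreal K * w" for w
    unfolding K_def using c \<alpha> by (intro suminf_geometric_truncated b) (simp add: one_less_power)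
  have fin: "(\<integral>\<^sup>+x. ennreal K * G A x \<partial>QD) < \<infinity>"
    by (simp add: nn_integral_cmult nn_integral_G ennreal_mult_less_top)
  have "(\<Sum>k. (\<integral>\<^sup>+x. (G_trunc A (s k) x)\<^sup>2 \<partial>QD) / ennreal (b k)) =
      (\<Sum>k. (\<integral>\<^sup>+x. (G_trunc A (s k) x)\<^sup>2 / ennreal (b k) \<partial>QD))"
    by (intro suminf_cong) (simp add: nn_integral_divide)
  also have "\<dots> = (\<integral>\<^sup>+x. (\<Sum>k. (G_trunc A (s k) x)\<^sup>2 / ennreal (b k)) \<partial>QD)"
    by (rule nn_integral_suminf[symmetric]) measurable
  also have "\<dots> \<le> (\<integral>\<^sup>+x. ennreal K * G A x \<partial>QD)"
  proof (intro nn_integral_mono order_trans[OF _ bound] suminf_le)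
    fix x k show "(G_trunc A (s k) x)\<^sup>2 / ennreal (b k) \<le> ?t (G A x) k"
      by (auto simp: G_trunc_def b_def)
  qed auto
  also note fin
  finally show "(\<Sum>k. (\<integral>\<^sup>+x. (G_trunc A (s k) x)\<^sup>2 \<partial>QD) / ennreal (real (s k) ^ card A)) < \<infinity>"
    by (simp add: b_def)
  have "(\<Sum>k. ennreal (b k) * emeasure QD {x\<in>space QD. ennreal (b k) < G A x}) =
      (\<Sum>k. \<integral>\<^sup>+x. ennreal (b k) * indicator {x\<in>space QD. ennreal (b k) < G A x} x \<partial>QD)"
    by (intro suminf_cong nn_integral_cmult_indicator[symmetric]) measurable
  also have "\<dots> = (\<integral>\<^sup>+x. (\<Sum>k. ennreal (b k) * indicator {x\<in>space QD. ennreal (b k) < G A x} x) \<partial>QD)"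
    by (rule nn_integral_suminf[symmetric]) measurable
  also have "\<dots> \<le> (\<integral>\<^sup>+x. ennreal K * G A x \<partial>QD)"
  proof (intro nn_integral_mono order_trans[OF _ bound] suminf_le)
    fix x k show "ennreal (b k) * indicator {x\<in>space QD. ennreal (b k) < G A x} x \<le> ?t (G A x) k"
      by (auto simp: indicator_def)
  qed auto
  also note fin
  finally show "(\<Sum>k. ennreal (real (s k) ^ card A) * emeasure QD {x\<in>space QD. ennreal (real (s k) ^ card A) < G A x}) < \<infinity>"
    by (simp add: b_def)
qed

text \<open>Each \<open>G A\<close> has finite mean and is finite almost everywhere; there the
  growing thresholds eventually exceed all of the finitely many values, and the truncation stops
  acting. Domination is by \<open>f\<close>.\<close>

lemma mean_tendsto: "mean \<longlonglongrightarrow> (\<integral>x. f x \<partial>QD)"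
  unfolding mean_def[abs_def]
proof (rule integral_dominated_convergence[where w = f])
  have "AE x in QD. \<forall>A\<in>parts. G A x \<noteq> \<infinity>"
    by (intro AE_finite_allI finite_parts nn_integral_PInf_AE) (simp_all add: nn_integral_G)
  then show "AE x in QD. (\<lambda>n. trunc n x) \<longlonglongrightarrow> f x"
  proof eventually_elim
    case (elim x)
    have "\<forall>\<^sub>F n in sequentially. \<forall>A\<in>parts. G A x \<le> ennreal (real n ^ card A)"
    proof (intro eventually_ball_finite finite_parts ballI)
      fix A assume A: "A \<in> parts"
      then have "finite A" "A \<noteq> {}" using finite_D finite_subset by auto
      then have c: "card A > 0" by (simp add: card_gt_0_iff)
      from elim A obtain r where r: "r \<ge> 0" "G A x = ennreal r"
        by (cases "G A x") auto
      show "\<forall>\<^sub>F n in sequentially. G A x \<le> ennreal (real n ^ card A)"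
        using eventually_ge_at_top[of "max 1 (nat \<lceil>r\<rceil>)"]
      proof eventually_elim
        case (elim n)
        then have "r \<le> real n" "1 \<le> real n" by linarith+
        then have "r \<le> real n ^ card A"
          using c self_le_power[of "real n" "card A"] by linarith
        then show ?case using r by (simp add: ennreal_leI)
      qed
    qed
    then have "\<forall>\<^sub>F n in sequentially. trunc n x = f x"
      by eventually_elim (rule trunc_eq, blast)
    then show ?case by (rule tendsto_eventually)
  qed
qed (auto simp: integrable_f f_nonneg trunc_nonneg trunc_le)

text \<open>Three parts combine: the centred truncated sums vanish, the truncation eventually
  changes no term, and the centring converges by \<open>mean_tendsto\<close> and the assumed growth
  of \<open>T\<close>.\<close>

lemma AE_tendsto_subsequence:
  fixes T :: "nat \<Rightarrow> ('k \<Rightarrow> nat) set" and \<alpha> c :: real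
  assumes T: "\<And>n. T n \<subseteq> tuples n" and \<alpha>: "\<alpha> > 1"
    and c: "(\<lambda>n. real (card (T n)) / real n ^ card D) \<longlonglongrightarrow> c"
  defines "s \<equiv> \<lambda>k. nat \<lceil>\<alpha> ^ k\<rceil>"
  shows "AE x in Q. (\<lambda>k. (\<Sum>i\<in>T (s k). f (pull i x)) / real (s k) ^ card D) \<longlonglongrightarrow> c * (\<integral>x. f x \<partial>QD)"
proof -
  interpret Q: prob_space Q by (rule prob_space_Q)
  have s: "\<alpha> ^ k \<le> real (s k)" for k
    unfolding s_def using ceiling_power_bounds[of \<alpha> k] \<alpha> by simp
  have s0: "s k > 0" for k
  proof -
    have "0 < \<alpha> ^ k" using \<alpha> by simp
    with s[of k] show ?thesis by (simp only: of_nat_0_less_iff[symmetric, where ?'a = real])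
  qed
  have s_lim: "filterlim s at_top sequentially"
  proof -
    have "filterlim (\<lambda>k. \<alpha> ^ k) at_top sequentially"
      using filterlim_realpow_sequentially_gt1[of \<alpha>] \<alpha>
      by (intro filterlim_at_infinity_imp_filterlim_at_top) auto
    then have "filterlim (\<lambda>k. real (s k)) at_top sequentially"
      by (rule filterlim_at_top_mono) (simp add: s)
    then show ?thesis by (simp add: filterlim_sequentially_iff_filterlim_real)
  qed
  have fin: "finite (T n)" for n using T finite_tuples finite_subset by blast
  have pull [measurable]: "(\<lambda>x. pull i x) \<in> Q \<rightarrow>\<^sub>M QD" if "i \<in> T n" for i n
    using that T measurable_pull by blast
  define Z where "Z k x = ((\<Sum>i\<in>T (s k). trunc (s k) (pull i x)) - real (card (T (s k))) * mean (s k)) / real (s k) ^ card D" for k x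
  have Z [measurable]: "Z k \<in> borel_measurable Q" for k
    unfolding Z_def[abs_def] by measurable
  have "(\<integral>\<^sup>+x. (\<Sum>k. ennreal ((Z k x)\<^sup>2)) \<partial>Q) = (\<Sum>k. \<integral>\<^sup>+x. ennreal ((Z k x)\<^sup>2) \<partial>Q)"
    by (rule nn_integral_suminf) measurable
  also have "\<dots> \<le> (\<Sum>k. \<Sum>A\<in>parts. ennreal (2 * real (card D) ^ card A) *
      ((\<integral>\<^sup>+x. (G_trunc A (s k) x)\<^sup>2 \<partial>QD) / ennreal (real (s k) ^ card A)))"
    unfolding Z_def by (intro suminf_le variance_trunc T s0) auto
  also have "\<dots> = (\<Sum>A\<in>parts. ennreal (2 * real (card D) ^ card A) *
      (\<Sum>k. (\<integral>\<^sup>+x. (G_trunc A (s k) x)\<^sup>2 \<partial>QD) / ennreal (real (s k) ^ card A)))"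
    by (subst suminf_sum) (simp_all add: ennreal_suminf_cmult)
  also have "\<dots> < \<infinity>"
    using suminf_G_trunc(1)[OF _ \<alpha>] finite_parts
    by (simp add: s_def ennreal_sum_less_top ennreal_mult_less_top del: Diff_iff Pow_iff)
  finally have "(\<integral>\<^sup>+x. (\<Sum>k. ennreal ((Z k x)\<^sup>2)) \<partial>Q) \<noteq> \<infinity>"
    by simp
  moreover have "(\<lambda>x. \<Sum>k. ennreal ((Z k x)\<^sup>2)) \<in> borel_measurable Q"
    by measurable
  ultimately have "AE x in Q. (\<Sum>k. ennreal ((Z k x)\<^sup>2)) \<noteq> \<infinity>"
    by (intro nn_integral_PInf_AE)
  \<comment> \<open>The series of squares has finite mean, so it converges almost everywhere and its
    terms tend to 0.\<close>
  then have Z0: "AE x in Q. (\<lambda>k. Z k x) \<longlonglongrightarrow> 0"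
  proof eventually_elim
    case (elim x)
    then have "summable (\<lambda>k. (Z k x)\<^sup>2)"
      by (intro summable_suminf_not_top) auto
    then have "(\<lambda>k. (Z k x)\<^sup>2) \<longlonglongrightarrow> 0" by (rule summable_LIMSEQ_zero)
    from tendsto_real_sqrt[OF this] show ?case by (simp add: tendsto_rabs_zero_iff)
  qed
  define B where "B k = {x\<in>space Q. \<exists>i\<in>T (s k). trunc (s k) (pull i x) \<noteq> f (pull i x)}" for k
  have B_sets: "B k \<in> sets Q" for k
  proof -
    have "B k = (\<Union>i\<in>T (s k). {x\<in>space Q. trunc (s k) (pull i x) \<noteq> f (pull i x)})"
      by (auto simp: B_def)
    also have "\<dots> \<in> sets Q"
      by (intro sets.finite_UN fin borel_measurable_neq) measurable
    finally show ?thesis .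
  qed
  have "(\<Sum>k. emeasure Q (B k)) \<le> (\<Sum>k. \<Sum>A\<in>parts. ennreal (real (s k) ^ card A) *
      emeasure QD {x\<in>space QD. ennreal (real (s k) ^ card A) < G A x})"
    unfolding B_def by (intro suminf_le emeasure_trunc_neq T) auto
  also have "\<dots> = (\<Sum>A\<in>parts. \<Sum>k. ennreal (real (s k) ^ card A) *
      emeasure QD {x\<in>space QD. ennreal (real (s k) ^ card A) < G A x})"
    by (subst suminf_sum) simp_all
  also have "\<dots> < \<infinity>"
    using suminf_G_trunc(2)[OF _ \<alpha>] finite_parts
    by (simp add: s_def ennreal_sum_less_top del: Diff_iff Pow_iff)
  finally have "(\<Sum>k. ennreal (measure Q (B k))) \<noteq> \<infinity>"
    unfolding Q.emeasure_eq_measure by simp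
  then have "summable (\<lambda>k. measure Q (B k))"
    by (intro summable_suminf_not_top) auto
  \<comment> \<open>Borel-Cantelli: almost surely only finitely many stages contain a changed
    term.\<close>
  then have "AE x in Q. \<forall>\<^sub>F k in sequentially. x \<in> space Q - B k"
    by (intro borel_cantelli_AE1 B_sets) (simp_all only: Q.emeasure_eq_measure ennreal_less_top infinity_ennreal_def)
  then show ?thesis
    using Z0
  proof eventually_elim
    case (elim x)
    have c': "(\<lambda>k. real (card (T (s k))) / real (s k) ^ card D) \<longlonglongrightarrow> c"
      by (rule filterlim_compose[OF c s_lim])
    have m': "(\<lambda>k. mean (s k)) \<longlonglongrightarrow> (\<integral>x. f x \<partial>QD)"
      by (rule filterlim_compose[OF mean_tendsto s_lim])
    have lim: "(\<lambda>k. Z k x + real (card (T (s k))) / real (s k) ^ card D * mean (s k)) \<longlonglongrightarrow> 0 + c * (\<integral>x. f x \<partial>QD)"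
      by (intro tendsto_add tendsto_mult c' m' elim)
    have "\<forall>\<^sub>F k in sequentially. Z k x + real (card (T (s k))) / real (s k) ^ card D * mean (s k) =
        (\<Sum>i\<in>T (s k). f (pull i x)) / real (s k) ^ card D"
      using elim(1)
    proof eventually_elim
      case (elim k)
      then have "trunc (s k) (pull i x) = f (pull i x)" if "i \<in> T (s k)" for i
        using that by (auto simp: B_def)
      then have "(\<Sum>i\<in>T (s k). trunc (s k) (pull i x)) = (\<Sum>i\<in>T (s k). f (pull i x))"
        by (intro sum.cong) auto
      then show ?case
        by (simp add: Z_def diff_divide_distrib)
    qed
    from Lim_transform_eventually[OF lim this] show ?case by simp
  qed
qed

text \<open>Growing \<open>T\<close> and nonnegative \<open>f\<close> make the sums nondecreasing in
  n, and the exceptional null sets of countably many ratios can be united.\<close>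

lemma AE_tendsto_sum_tuples:
  fixes T :: "nat \<Rightarrow> ('k \<Rightarrow> nat) set" and c :: real
  assumes T: "\<And>n. T n \<subseteq> tuples n" and mono: "mono T"
    and c: "(\<lambda>n. real (card (T n)) / real n ^ card D) \<longlonglongrightarrow> c"
  shows "AE x in Q. (\<lambda>n. (\<Sum>i\<in>T n. f (pull i x)) / real n ^ card D) \<longlonglongrightarrow> c * (\<integral>x. f x \<partial>QD)"
proof -
  have fin: "finite (T n)" for n using T finite_tuples finite_subset by blast
  have "AE x in Q. \<forall>m. (\<lambda>k. (\<Sum>i\<in>T (nat \<lceil>(1 + 1 / real (Suc m)) ^ k\<rceil>). f (pull i x)) /
      real (nat \<lceil>(1 + 1 / real (Suc m)) ^ k\<rceil>) ^ card D) \<longlonglongrightarrow> c * (\<integral>x. f x \<partial>QD)"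
    unfolding AE_all_countable by (intro allI AE_tendsto_subsequence T c) simp
  then show ?thesis
  proof eventually_elim
    case (elim x)
    show ?case
    proof (rule tendsto_if_tendsto_geometric_subsequences)
      show "mono (\<lambda>n. \<Sum>i\<in>T n. f (pull i x))"
        using mono fin f_nonneg by (intro monoI sum_mono2) (auto dest: monoD)
    qed (use elim f_nonneg in \<open>auto intro: sum_nonneg\<close>)
  qed
qed

end

subsection \<open>The law of large numbers\<close>

text \<open>The constant \<open>1 / fact d\<close> appears both in the limit of the sum and in that
  of the binomial coefficient, and cancels in the quotient.\<close>

lemma (in prob_space) U_stat_product_space:
  fixes f :: "(nat \<Rightarrow> 'a) \<Rightarrow> real"
  assumes "d \<ge> 1" and int: "integrable (PiM {1..d} (\<lambda>_. M)) f" and "\<And>x. 0 \<le> f x"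
  shows "AE x in PiM {1..} (\<lambda>_. M). (\<lambda>n. U_stat d f (\<lambda>i x. x i) n x / real (n choose d)) \<longlonglongrightarrow>
    (\<integral>x. f x \<partial>PiM {1..d} (\<lambda>_. M))"
proof -
  interpret integrable_kernel M "{1..d}" f
    using assms by unfold_locales auto
  have c: "(\<lambda>n. real (card (index_tuples d n)) / real n ^ card {1..d}) \<longlonglongrightarrow> 1 / fact d"
    using binomial_asymptotic[of d] by (simp add: card_index_tuples)
  have "AE x in Q. (\<lambda>n. (\<Sum>i\<in>index_tuples d n. f (pull i x)) / real n ^ card {1..d}) \<longlonglongrightarrow>
      1 / fact d * (\<integral>x. f x \<partial>QD)"
  proof (rule AE_tendsto_sum_tuples[OF _ _ c])
    show "index_tuples d n \<subseteq> tuples n" for n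
      unfolding tuples_def using index_tuples_inj[of _ d n] unfolding index_tuples_def by blast
    show "mono (index_tuples d)"
      by (intro monoI index_tuples_mono)
  qed
  then show ?thesis
  proof eventually_elim
    case (elim x)
    let ?U = "\<lambda>n. \<Sum>i\<in>index_tuples d n. f (pull i x)"
    have "(\<lambda>n. (?U n / real n ^ d) / (real (n choose d) / real n ^ d)) \<longlonglongrightarrow>
        (1 / fact d * (\<integral>x. f x \<partial>QD)) / (1 / fact d)"
      using elim by (intro tendsto_divide binomial_asymptotic) simp_all
    moreover have "\<forall>\<^sub>F n in sequentially. (?U n / real n ^ d) / (real (n choose d) / real n ^ d) =
        U_stat d f (\<lambda>i x. x i) n x / real (n choose d)"
      using eventually_gt_at_top[of 0] by eventually_elim (simp add: U_stat_def)
    ultimately have "(\<lambda>n. U_stat d f (\<lambda>i x. x i) n x / real (n choose d)) \<longlonglongrightarrow>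
        (1 / fact d * (\<integral>x. f x \<partial>QD)) / (1 / fact d)"
      by (rule Lim_transform_eventually)
    then show ?case by simp
  qed
qed

theorem theorem3p1:
  fixes M :: "'a measure" and S :: "'s measure"
    and X :: "nat \<Rightarrow> 'a \<Rightarrow> 's"
    and d :: nat and f :: "(nat \<Rightarrow> 's) \<Rightarrow> real" and \<mu> :: real
  assumes "prob_space M"
    and "iid_sequence M S X"
    and "d \<ge> 1"
    and "f \<in> borel_measurable (PiM {1..d} (\<lambda>_. S))"
    and "integrable M (\<lambda>\<omega>. f (\<lambda>k\<in>{1..d}. X k \<omega>))"
    and "\<mu> = (\<integral>\<omega>. f (\<lambda>k\<in>{1..d}. X k \<omega>) \<partial>M)"
  shows "AE \<omega> in M. (\<lambda>n. U_stat d f X n \<omega> / real (n choose d)) \<longlonglongrightarrow> \<mu>"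
proof -
  interpret prob_space M by fact
  \<comment> \<open>The common law is read off from \<open>X 1\<close>, since \<open>X 0\<close> is
    unconstrained.\<close>
  define P where "P = distr M S (X 1)"
  have indep: "indep_vars (\<lambda>_. S) X {1..}" and dist: "\<And>i. i \<ge> 1 \<Longrightarrow> distr M S (X i) = P"
    using assms(2) unfolding iid_sequence_def P_def by blast+
  have X: "X i \<in> M \<rightarrow>\<^sub>M S" if "i \<ge> 1" for i
    using that indep unfolding indep_vars_def2 by auto
  interpret P: prob_space P
    unfolding P_def by (rule prob_space_distr) (simp add: X)
  \<comment> \<open>This is used twice: for \<open>{1..d}\<close>, nonempty as
    \<open>d \<ge> 1\<close>, it gives the law of the argument of \<open>f\<close>, and for
    \<open>{1..}\<close> the law of the whole path.\<close>
  have law: "distr M (PiM J (\<lambda>_. S)) (\<lambda>\<omega>. \<lambda>i\<in>J. X i \<omega>) = PiM J (\<lambda>_. P)"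
    if "J \<subseteq> {1..}" "J \<noteq> {}" for J
  proof -
    have "distr M (PiM J (\<lambda>_. S)) (\<lambda>\<omega>. \<lambda>i\<in>J. X i \<omega>) = (\<Pi>\<^sub>M i\<in>J. distr M S (X i))"
      using that X by (intro indep_vars_iff_distr_eq_PiM'[THEN iffD1] indep_vars_subset[OF indep]) auto
    also have "\<dots> = PiM J (\<lambda>_. P)"
      using that dist by (intro PiM_cong refl) auto
    finally show ?thesis .
  qed
  have Xr: "(\<lambda>\<omega>. \<lambda>i\<in>J. X i \<omega>) \<in> M \<rightarrow>\<^sub>M PiM J (\<lambda>_. S)" if "J \<subseteq> {1..}" for J
    using that X by (intro measurable_restrict) auto
  have lawD: "distr M (PiM {1..d} (\<lambda>_. S)) (\<lambda>\<omega>. \<lambda>i\<in>{1..d}. X i \<omega>) = PiM {1..d} (\<lambda>_. P)"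
    using \<open>d \<ge> 1\<close> by (intro law) auto
  have int: "integrable (PiM {1..d} (\<lambda>_. P)) f"
    unfolding lawD[symmetric] using assms(4,5) Xr[of "{1..d}"] by (subst integrable_distr_eq) auto
  have \<mu>: "\<mu> = (\<integral>x. f x \<partial>PiM {1..d} (\<lambda>_. P))"
    unfolding lawD[symmetric] using assms(4,6) Xr[of "{1..d}"] by (subst integral_distr) auto
  \<comment> \<open>The result for nonnegative kernels is applied to both parts of \<open>f\<close>;
    the U-statistic and the mean are linear in the kernel.\<close>
  let ?f1 = "\<lambda>x. max 0 (f x)" and ?f2 = "\<lambda>x. max 0 (- f x)"
  have f12: "f x = ?f1 x - ?f2 x" for x by auto
  have int12: "integrable (PiM {1..d} (\<lambda>_. P)) ?f1" "integrable (PiM {1..d} (\<lambda>_. P)) ?f2"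
    using int by (auto intro!: integrable_max)
  let ?U = "\<lambda>f n x. U_stat d f (\<lambda>i x. x i) n x / real (n choose d)"
  have "AE x in PiM {1..} (\<lambda>_. P). (\<lambda>n. ?U ?f1 n x) \<longlonglongrightarrow> (\<integral>x. ?f1 x \<partial>PiM {1..d} (\<lambda>_. P))"
    by (rule P.U_stat_product_space[OF \<open>d \<ge> 1\<close> int12(1)]) simp
  moreover have "AE x in PiM {1..} (\<lambda>_. P). (\<lambda>n. ?U ?f2 n x) \<longlonglongrightarrow> (\<integral>x. ?f2 x \<partial>PiM {1..d} (\<lambda>_. P))"
    by (rule P.U_stat_product_space[OF \<open>d \<ge> 1\<close> int12(2)]) simp
  ultimately have "AE x in PiM {1..} (\<lambda>_. P). (\<lambda>n. ?U f n x) \<longlonglongrightarrow> \<mu>"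
  proof eventually_elim
    case (elim x)
    have U: "?U f n x = ?U ?f1 n x - ?U ?f2 n x" for n
      unfolding U_stat_def diff_divide_distrib[symmetric] sum_subtractf[symmetric] f12[symmetric] ..
    have m: "\<mu> = (\<integral>x. ?f1 x \<partial>PiM {1..d} (\<lambda>_. P)) - (\<integral>x. ?f2 x \<partial>PiM {1..d} (\<lambda>_. P))"
      unfolding \<mu> Bochner_Integration.integral_diff[OF int12, symmetric] f12[symmetric] ..
    show ?case
      unfolding U m by (intro tendsto_diff elim)
  qed
  \<comment> \<open>The product is the image of \<open>M\<close> under the path map, so the
    exceptional null set pulls back to \<open>M\<close>.\<close>
  then have "AE x in distr M (PiM {1..} (\<lambda>_. S)) (\<lambda>\<omega>. \<lambda>i\<in>{1..}. X i \<omega>). (\<lambda>n. ?U f n x) \<longlonglongrightarrow> \<mu>"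
    by (subst law) auto
  then have "AE \<omega> in M. (\<lambda>n. ?U f n (\<lambda>i\<in>{1..}. X i \<omega>)) \<longlonglongrightarrow> \<mu>"
    by (rule AE_distrD[OF Xr[OF subset_refl]])
  \<comment> \<open>Indices in a tuple are at least 1, so restricting the path to
    \<open>{1..}\<close> changes none of the values used.\<close>
  moreover have "U_stat d f (\<lambda>i x. x i) n (\<lambda>i\<in>{1..}. X i \<omega>) = U_stat d f X n \<omega>" for n \<omega>
    unfolding U_stat_def
  proof (intro sum.cong refl arg_cong[where f = f] restrict_ext)
    fix i k assume "i \<in> index_tuples d n" "k \<in> {1..d}"
    then have "i k \<in> {1..n}" using index_tuples_image by blast
    then show "(\<lambda>i\<in>{1..}. X i \<omega>) (i k) = X (i k) \<omega>" by simp
  qed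
  ultimately show ?thesis by simp
qed

end
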